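(* Let $\omega$ be such that two $n\times n$ matrices can be multiplied in time $O(n^\omega)$, and let $P$ be a fixed pattern. There exists an algorithm solving $P$-Detection on ordered graphs with $n$ vertices in time $O(n^{\omega(\mathrm{dist}_{out}(P)+1)})$.
   Context: A pattern $P$ consists of a finite totally ordered vertex set $V(P)$ with a partition of the unordered pairs of distinct vertices into mandatory edges $M(P)$, forbidden edges $F(P)$ and undecided pairs $U(P)$; the edges of $P$ are the elements of $M(P)\cup F(P)$. Two edges $(i,j),(i',j')$ with $i<j$, $i'<j'$ cross if $i<i'<j<j'$ or $i'<i<j'<j$; $P$ is outerplanar if no two edges cross. $\mathrm{dist}_{out}(P)$ is the minimum number of edges to remove from $P$ so that it becomes outerplanar. An ordered graph $(G,\tau)$ contains $P$ if there is $X\subseteq V(G)$, $|X|=|V(P)|$, such that under the order-preserving bijection $X\to V(P)$ all mandatory pairs are edges and all forbidden pairs are non-edges of $G$. $P$-Detection: given $(G,\tau)$, decide whether it contains $P$. *)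

theory Defs
  imports
    "HOL-Library.Landau_Symbols"
    "Jordan_Normal_Form.Matrix"
begin

section \<open>Patterns\<close>

definition pairs :: "'a set \<Rightarrow> 'a set set" where
  "pairs V = {e. e \<subseteq> V \<and> card e = 2}"

record 'a pattern =
  pverts :: "'a set"
  mandatory :: "'a set set"
  forbidden :: "'a set set"
  undecided :: "'a set set"

text \<open>The total order on the vertices is the one of the (arbitrary) linear order type
  from which the vertices are taken.\<close>

definition is_pattern :: "'a::linorder pattern \<Rightarrow> bool" where
  "is_pattern P \<longleftrightarrow>
     finite (pverts P) \<and>
     mandatory P \<union> forbidden P \<union> undecided P = pairs (pverts P) \<and>
     mandatory P \<inter> forbidden P = {} \<and>
     mandatory P \<inter> undecided P = {} \<and>
     forbidden P \<inter> undecided P = {}"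

definition pedges :: "'a pattern \<Rightarrow> 'a set set" where
  "pedges P = mandatory P \<union> forbidden P"

definition cross :: "'a::linorder set \<Rightarrow> 'a set \<Rightarrow> bool" where
  "cross e e' \<longleftrightarrow>
     (\<exists>i j i' j'. e = {i, j} \<and> i < j \<and> e' = {i', j'} \<and> i' < j' \<and>
        (i < i' \<and> i' < j \<and> j < j' \<or> i' < i \<and> i < j' \<and> j' < j))"

definition outerplanar :: "'a::linorder pattern \<Rightarrow> bool" where
  "outerplanar P \<longleftrightarrow> (\<forall>e \<in> pedges P. \<forall>e' \<in> pedges P. \<not> cross e e')"

text \<open>A removed edge becomes an undecided pair.\<close>

definition remove_edges :: "'a pattern \<Rightarrow> 'a set set \<Rightarrow> 'a pattern" where
  "remove_edges P S =
     P\<lparr>mandatory := mandatory P - S, forbidden := forbidden P - S,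
       undecided := undecided P \<union> S\<rparr>"

definition dist_out :: "'a::linorder pattern \<Rightarrow> nat" where
  "dist_out P =
     (LEAST d. \<exists>S. S \<subseteq> pedges P \<and> card S = d \<and> outerplanar (remove_edges P S))"


section \<open>Ordered graphs\<close>

text \<open>The ordering is represented by the list of all vertices in increasing order.\<close>

record 'v ordered_graph =
  gverts :: "'v set"
  gedges :: "'v set set"
  gorder :: "'v list"

definition is_ordered_graph :: "'v ordered_graph \<Rightarrow> bool" where
  "is_ordered_graph G \<longleftrightarrow>
     gedges G \<subseteq> pairs (gverts G) \<and> distinct (gorder G) \<and> set (gorder G) = gverts G"

definition before :: "'v ordered_graph \<Rightarrow> 'v \<Rightarrow> 'v \<Rightarrow> bool" where
  "before G x y \<longleftrightarrow>
     (\<exists>i j. i < j \<and> j < length (gorder G) \<and> gorder G ! i = x \<and> gorder G ! j = y)"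

definition contains_pattern :: "'v ordered_graph \<Rightarrow> 'a::linorder pattern \<Rightarrow> bool" where
  "contains_pattern G P \<longleftrightarrow>
     (\<exists>X \<subseteq> gverts G. card X = card (pverts P) \<and>
       (\<exists>f. bij_betw f X (pverts P) \<and>
          (\<forall>x\<in>X. \<forall>y\<in>X. before G x y \<longrightarrow> f x < f y) \<and>
          (\<forall>x\<in>X. \<forall>y\<in>X. {f x, f y} \<in> mandatory P \<longrightarrow> {x, y} \<in> gedges G) \<and>
          (\<forall>x\<in>X. \<forall>y\<in>X. {f x, f y} \<in> forbidden P \<longrightarrow> {x, y} \<notin> gedges G)))"


section \<open>The word RAM\<close>

text \<open>
  A structured word RAM. The memory consists of registers and of random access arrays; a
  program mentions only finitely many of them, so the arrays can be interleaved in one linear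
  memory at constant overhead. The parameter \<open>w\<close> below is the word length: cells hold integers
  of absolute value less than \<open>2 ^ w\<close>, and an operation whose result does not fit has no
  result, so that a program that overflows has no execution.
\<close>

datatype binop = Add | Sub | Mul | Div | Mod | And | Or | Xor | Shl | Shr | Less | Eq

datatype expr =
    Const int
  | Reg nat
  | Load nat expr   \<comment> \<open>array, index\<close>
  | Op binop expr expr

datatype com =
    Skip
  | Assign nat expr
  | Store nat expr expr   \<comment> \<open>array, index, value\<close>
  | Seq com com
  | Cond expr com com
  | While expr com

record state =
  regs :: "nat \<Rightarrow> int"
  arrs :: "nat \<Rightarrow> nat \<Rightarrow> int"

fun apply_op :: "binop \<Rightarrow> int \<Rightarrow> int \<Rightarrow> int" where
  "apply_op Add x y = x + y"
| "apply_op Sub x y = x - y"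
| "apply_op Mul x y = x * y"
| "apply_op Div x y = x div y"
| "apply_op Mod x y = x mod y"
| "apply_op And x y = Bit_Operations.and x y"
| "apply_op Or x y = Bit_Operations.or x y"
| "apply_op Xor x y = Bit_Operations.xor x y"
| "apply_op Shl x y = push_bit (nat y) x"
| "apply_op Shr x y = drop_bit (nat y) x"
| "apply_op Less x y = (if x < y then 1 else 0)"
| "apply_op Eq x y = (if x = y then 1 else 0)"

definition fits :: "nat \<Rightarrow> int \<Rightarrow> bool" where
  "fits w v \<longleftrightarrow> \<bar>v\<bar> < 2 ^ w"

definition word :: "nat \<Rightarrow> int \<Rightarrow> int option" where
  "word w v = (if fits w v then Some v else None)"

fun eval :: "nat \<Rightarrow> state \<Rightarrow> expr \<Rightarrow> int option" where
  "eval w s (Const v) = word w v"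
| "eval w s (Reg x) = Some (regs s x)"
| "eval w s (Load a e) =
     Option.bind (eval w s e) (\<lambda>i. if 0 \<le> i then Some (arrs s a (nat i)) else None)"
| "eval w s (Op f e1 e2) =
     Option.bind (eval w s e1) (\<lambda>x. Option.bind (eval w s e2) (\<lambda>y. word w (apply_op f x y)))"

text \<open>Every constant, memory access and operation has unit cost.\<close>

fun cost :: "expr \<Rightarrow> nat" where
  "cost (Const v) = 1"
| "cost (Reg x) = 1"
| "cost (Load a e) = cost e + 1"
| "cost (Op f e1 e2) = cost e1 + cost e2 + 1"

text \<open>\<open>exec w c s t s'\<close>: with word length \<open>w\<close>, the program \<open>c\<close> started in \<open>s\<close> halts after
  \<open>t\<close> steps in \<open>s'\<close>.\<close>

inductive exec :: "nat \<Rightarrow> com \<Rightarrow> state \<Rightarrow> nat \<Rightarrow> state \<Rightarrow> bool" for w where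
  Skip: "exec w Skip s 1 s"
| Assign: "eval w s e = Some v \<Longrightarrow>
    exec w (Assign x e) s (cost e + 1) (s\<lparr>regs := (regs s)(x := v)\<rparr>)"
| Store: "eval w s e1 = Some i \<Longrightarrow> 0 \<le> i \<Longrightarrow> eval w s e2 = Some v \<Longrightarrow>
    exec w (Store a e1 e2) s (cost e1 + cost e2 + 1)
      (s\<lparr>arrs := (arrs s)(a := (arrs s a)(nat i := v))\<rparr>)"
| Seq: "exec w c1 s t1 s' \<Longrightarrow> exec w c2 s' t2 s'' \<Longrightarrow> exec w (Seq c1 c2) s (t1 + t2) s''"
| CondTrue: "eval w s e = Some v \<Longrightarrow> v \<noteq> 0 \<Longrightarrow> exec w c1 s t s' \<Longrightarrow>
    exec w (Cond e c1 c2) s (cost e + 1 + t) s'"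
| CondFalse: "eval w s e = Some 0 \<Longrightarrow> exec w c2 s t s' \<Longrightarrow>
    exec w (Cond e c1 c2) s (cost e + 1 + t) s'"
| WhileFalse: "eval w s e = Some 0 \<Longrightarrow> exec w (While e c) s (cost e + 1) s"
| WhileTrue: "eval w s e = Some v \<Longrightarrow> v \<noteq> 0 \<Longrightarrow> exec w c s t1 s' \<Longrightarrow>
    exec w (While e c) s' t2 s'' \<Longrightarrow> exec w (While e c) s (cost e + 1 + t1 + t2) s''"

inductive_cases exec_elims:
  "exec w Skip s t s'"
  "exec w (Assign x e) s t s'"
  "exec w (Store a e1 e2) s t s'"
  "exec w (Seq c1 c2) s t s'"
  "exec w (Cond e c1 c2) s t s'"
  "exec w (While e c) s t s'"

lemma exec_deterministic:
  "exec w c s t s' \<Longrightarrow> exec w c s u s'' \<Longrightarrow> t = u \<and> s' = s''"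
proof (induction arbitrary: u s'' rule: exec.induct)
  case (Skip s)
  then show ?case by (rule exec_elims(1)) simp
next
  case (Assign s e v x)
  from Assign.prems Assign.hyps show ?case by (elim exec_elims(2)) simp
next
  case (Store s e1 i e2 v a)
  from Store.prems Store.hyps show ?case by (elim exec_elims(3)) simp
next
  case (Seq c1 s t1 s' c2 t2 s2)
  from Seq.prems show ?case by (rule exec_elims(4)) (metis Seq.IH)
next
  case (CondTrue s e v c1 t s' c2)
  from CondTrue.prems CondTrue.hyps(1,2) CondTrue.IH show ?case by (elim exec_elims(5)) auto
next
  case (CondFalse s e c2 t s' c1)
  from CondFalse.prems CondFalse.hyps(1) CondFalse.IH show ?case by (elim exec_elims(5)) auto
next
  case (WhileFalse s e c)
  from WhileFalse.prems show ?case by (rule exec_elims(6)) (use WhileFalse.hyps in auto)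
next
  case (WhileTrue s e v c t1 s' t2 s2)
  from WhileTrue.prems show ?case
  proof (rule exec_elims(6))
    fix v' :: int and u1 r u2
    assume "u = Suc (cost e + u1 + u2)" and "exec w c s u1 r" "exec w (While e c) r u2 s''"
    moreover from this have "t1 = u1" "s' = r" using WhileTrue.IH(1) by auto
    ultimately show ?thesis using WhileTrue.IH(2) by auto
  qed (use WhileTrue.hyps in auto)
qed

definition word_state :: "nat \<Rightarrow> state \<Rightarrow> bool" where
  "word_state w s \<longleftrightarrow> (\<forall>x. fits w (regs s x)) \<and> (\<forall>a i. fits w (arrs s a i))"

text \<open>
  \<open>solves_in_time c enc out g\<close>: \<open>c\<close> runs in time \<open>O(g n)\<close> on words of \<open>O(log n)\<close> bits.
  Here \<open>enc n x s\<close> says that the memory \<open>s\<close> holds the instance \<open>x\<close> of size \<open>n\<close>, and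
  \<open>out n x s'\<close> that \<open>s'\<close> holds a correct answer for \<open>x\<close>. As usual for the word RAM, the
  program has to work for every word length that is at least \<open>b n\<close>. Cells not constrained by
  \<open>enc\<close> are uninitialised, that is, they may hold arbitrary words.
\<close>

definition solves_in_time ::
    "com \<Rightarrow> (nat \<Rightarrow> 'x \<Rightarrow> state \<Rightarrow> bool) \<Rightarrow> (nat \<Rightarrow> 'x \<Rightarrow> state \<Rightarrow> bool) \<Rightarrow> (nat \<Rightarrow> real) \<Rightarrow> bool" where
  "solves_in_time c enc out g \<longleftrightarrow>
     (\<exists>(T :: nat \<Rightarrow> nat) (b :: nat \<Rightarrow> nat).
        (\<lambda>n. real (T n)) \<in> O(g) \<and>
        (\<lambda>n. real (b n)) \<in> O(\<lambda>n. ln (real n)) \<and>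
        (\<forall>n x w s. b n \<le> w \<longrightarrow> word_state w s \<longrightarrow> enc n x s \<longrightarrow>
           (\<exists>t s'. exec w c s t s' \<and> t \<le> T n \<and> out n x s')))"


section \<open>Matrix multiplication\<close>

definition holds_matrix :: "state \<Rightarrow> nat \<Rightarrow> nat \<Rightarrow> int mat \<Rightarrow> bool" where
  "holds_matrix s a n A \<longleftrightarrow> (\<forall>i<n. \<forall>j<n. arrs s a (i * n + j) = A $$ (i, j))"

definition small_matrix :: "nat \<Rightarrow> nat \<Rightarrow> int mat \<Rightarrow> bool" where
  "small_matrix k n A \<longleftrightarrow> A \<in> carrier_mat n n \<and> (\<forall>i<n. \<forall>j<n. \<bar>A $$ (i, j)\<bar> \<le> int n ^ k)"

definition mm_input :: "nat \<Rightarrow> nat \<Rightarrow> int mat \<times> int mat \<Rightarrow> state \<Rightarrow> bool" where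
  "mm_input k n = (\<lambda>(A, B) s. small_matrix k n A \<and> small_matrix k n B \<and>
     regs s 0 = int n \<and> holds_matrix s 0 n A \<and> holds_matrix s 1 n B)"

definition mm_output :: "nat \<Rightarrow> int mat \<times> int mat \<Rightarrow> state \<Rightarrow> bool" where
  "mm_output n = (\<lambda>(A, B) s. holds_matrix s 2 n (A * B))"

text \<open>Two \<open>n \<times> n\<close> integer matrices whose entries have \<open>O(log n)\<close> bits can be multiplied in
  time \<open>O(g n)\<close>.\<close>

definition matrix_multiplication_in_time :: "(nat \<Rightarrow> real) \<Rightarrow> bool" where
  "matrix_multiplication_in_time g \<longleftrightarrow> (\<forall>k. \<exists>c. solves_in_time c (mm_input k) mm_output g)"


section \<open>Pattern detection\<close>

text \<open>The vertices of an input graph are \<open>0, \<dots>, n - 1\<close>; array \<open>0\<close> holds the adjacency matrix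
  and array \<open>1\<close> the ordering.\<close>

definition detection_input :: "nat \<Rightarrow> nat ordered_graph \<Rightarrow> state \<Rightarrow> bool" where
  "detection_input n G s \<longleftrightarrow>
     is_ordered_graph G \<and> gverts G = {..<n} \<and>
     regs s 0 = int n \<and>
     (\<forall>i<n. \<forall>j<n. arrs s 0 (i * n + j) = (if {i, j} \<in> gedges G then 1 else 0)) \<and>
     (\<forall>i<n. arrs s 1 i = int (gorder G ! i))"

definition detection_output ::
    "'a::linorder pattern \<Rightarrow> nat \<Rightarrow> nat ordered_graph \<Rightarrow> state \<Rightarrow> bool" where
  "detection_output P n G s \<longleftrightarrow> regs s 0 = (if contains_pattern G P then 1 else 0)"

definition detects_in_time :: "com \<Rightarrow> 'a::linorder pattern \<Rightarrow> (nat \<Rightarrow> real) \<Rightarrow> bool" where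
  "detects_in_time c P g \<longleftrightarrow> solves_in_time c detection_input (detection_output P) g"

end

theory Submission
  imports Defs "HOL-Real_Asymp.Real_Asymp"
begin

text \<open>
  Choose a set of \<open>d = dist_out P\<close> edges whose removal makes the pattern outerplanar, and try all
  \<open>n ^ (2 * d)\<close> positions of their endpoints in the graph. Once these are fixed, it remains to embed
  an outerplanar pattern with some prescribed vertices. For an interval \<open>[i, j]\<close> of pattern vertices,
  let \<open>D\<^sub>i\<^sub>j\<close> be the Boolean matrix whose entry \<open>(x, y)\<close> says whether the interval embeds with \<open>i\<close>
  mapped to \<open>x\<close> and \<open>j\<close> to \<open>y\<close>. As no edges cross, the interval has an inner vertex \<open>m\<close> that
  no edge other than \<open>(i, j)\<close> passes over, so that \<open>D\<^sub>i\<^sub>j\<close> is the Boolean product of \<open>D\<^sub>i\<^sub>m\<close> and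
  \<open>D\<^sub>m\<^sub>j\<close>, restricted by the constraint on the pair \<open>(i, j)\<close>. This takes \<open>O(n ^ \<omega>)\<close> steps per guess,
  and \<open>2 * d + \<omega> \<le> \<omega> * (d + 1)\<close> since \<open>2 \<le> \<omega>\<close>: a multiplication has to write \<open>n\<^sup>2\<close> cells.
\<close>

section \<open>Programs on the word RAM\<close>

lemma less_square_div_mod:
  fixes n q :: nat
  assumes "q < n * n"
  shows "q div n < n" "q mod n < n"
  using assms by (cases "n = 0"; simp add: less_mult_imp_div_less)+

lemma cell_less_square:
  fixes n i j :: nat
  assumes "i < n" "j < n"
  shows "i * n + j < n * n"
proof -
  have "i * n + j < Suc i * n" using assms by simp
  also have "\<dots> \<le> n * n" using assms by (intro mult_le_mono) auto
  finally show ?thesis .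
qed

section \<open>What an execution preserves and how much it can change\<close>

lemma eval_fits: "word_state w s \<Longrightarrow> eval w s e = Some v \<Longrightarrow> fits w v"
  by (cases e) (auto simp: word_def word_state_def bind_eq_Some_conv split: if_splits)

lemma exec_word_state: "exec w c s t s' \<Longrightarrow> word_state w s \<Longrightarrow> word_state w s'"
proof (induction rule: exec.induct)
  case (Assign s e v x)
  then show ?case using eval_fits[of w s e v] by (auto simp: word_state_def)
next
  case (Store s e1 i e2 v a)
  then show ?case using eval_fits[of w s e2 v] by (auto simp: word_state_def)
qed auto

text \<open>One number bounds the written registers and arrays alike; reads are unrestricted. Memory
  from this index on survives the multiplication, so the detection program can live there.\<close>

fun write_bound :: "com \<Rightarrow> nat" where
  "write_bound Skip = 0"
| "write_bound (Assign x e) = Suc x"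
| "write_bound (Store a e1 e2) = Suc a"
| "write_bound (Seq c1 c2) = max (write_bound c1) (write_bound c2)"
| "write_bound (Cond e c1 c2) = max (write_bound c1) (write_bound c2)"
| "write_bound (While e c) = write_bound c"

lemma exec_frame:
  assumes "exec w c s t s'" "write_bound c \<le> r"
  shows "regs s' r = regs s r" "arrs s' r = arrs s r"
  using assms by (induction rule: exec.induct) auto

text \<open>Only \<open>Store\<close> touches an array; it alters at most one cell and costs at
  least one step. So the number of cells that end up different is a lower bound for the
  time.\<close>

lemma exec_changed_cells:
  "exec w c s t s' \<Longrightarrow>
     finite {i. arrs s' a i \<noteq> arrs s a i} \<and> card {i. arrs s' a i \<noteq> arrs s a i} \<le> t"
proof (induction rule: exec.induct)
  case (Store s e1 i e2 v b)
  have "{j. (if b = a then (arrs s b)(nat i := v) else arrs s a) j \<noteq> arrs s a j} \<subseteq> {nat i}"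
    by auto
  from finite_subset[OF this] card_mono[OF _ this] show ?case by (auto split: if_splits)
next
  case (Seq c1 s t1 s' c2 t2 s'')
  have sub: "{i. arrs s'' a i \<noteq> arrs s a i} \<subseteq>
      {i. arrs s' a i \<noteq> arrs s a i} \<union> {i. arrs s'' a i \<noteq> arrs s' a i}"
    by auto
  show ?case using finite_subset[OF sub] card_mono[OF _ sub] Seq.IH
      card_Un_le[of "{i. arrs s' a i \<noteq> arrs s a i}" "{i. arrs s'' a i \<noteq> arrs s' a i}"]
    by auto
next
  case (WhileTrue s e v c t1 s' t2 s'')
  have sub: "{i. arrs s'' a i \<noteq> arrs s a i} \<subseteq>
      {i. arrs s' a i \<noteq> arrs s a i} \<union> {i. arrs s'' a i \<noteq> arrs s' a i}"
    by auto
  show ?case using finite_subset[OF sub] card_mono[OF _ sub] WhileTrue.IH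
      card_Un_le[of "{i. arrs s' a i \<noteq> arrs s a i}" "{i. arrs s'' a i \<noteq> arrs s' a i}"]
    by auto
qed auto

lemma fits_0 [simp]: "fits w 0"
  by (simp add: fits_def)

text \<open>The product of two zero matrices has to be written into an output array full of ones.\<close>

lemma matrix_multiplication_exponent:
  fixes \<omega> :: real
  assumes "matrix_multiplication_in_time (\<lambda>n. real n powr \<omega>)"
  shows "2 \<le> \<omega>"
proof -
  obtain c T b where T: "(\<lambda>n. real (T n)) \<in> O(\<lambda>n. real n powr \<omega>)"
    and c: "\<And>n x w s. b n \<le> w \<Longrightarrow> word_state w s \<Longrightarrow> mm_input 0 n x s \<Longrightarrow>
      \<exists>t s'. exec w c s t s' \<and> t \<le> T n \<and> mm_output n x s'"
    using assms unfolding matrix_multiplication_in_time_def solves_in_time_def by metis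
  have ge: "n\<^sup>2 \<le> T n" for n :: nat
  proof -
    \<comment> \<open>The word length must suit the multiplication program and make
      \<open>n\<close>, which is stored in register 0, a word; \<open>w \<ge> 1\<close> also makes
      the ones in the output array words.\<close>
    define w where "w = max (b n) (n + 1)"
    define s where "s = \<lparr>regs = \<lambda>r. if r = 0 then int n else 0,
      arrs = \<lambda>a i. if a = 2 then 1 else 0\<rparr>"
    have "n < 2 ^ w"
      unfolding w_def by (rule less_le_trans[OF less_exp]) (simp add: power_increasing)
    then have "int n < 2 ^ w"
      by (metis of_nat_less_iff of_nat_numeral of_nat_power)
    moreover have "(1::int) < 2 ^ w"
      by (simp add: w_def)
    ultimately have "word_state w s"
      by (auto simp: word_state_def s_def fits_def)
    moreover have "mm_input 0 n (0\<^sub>m n n, 0\<^sub>m n n) s"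
      by (auto simp: mm_input_def small_matrix_def holds_matrix_def s_def less_mult_imp_div_less)
    ultimately obtain t s' where ex: "exec w c s t s'" and t: "t \<le> T n"
      and out: "mm_output n (0\<^sub>m n n, 0\<^sub>m n n) s'"
      using c[of n w s "(0\<^sub>m n n, 0\<^sub>m n n)"] by (auto simp: w_def)
    have "arrs s' 2 q = 0" if "q < n\<^sup>2" for q
    proof -
      have "q div n < n" "q mod n < n"
        using that less_square_div_mod[of q n] by (simp_all add: power2_eq_square)
      moreover have "\<forall>i<n. \<forall>j<n. arrs s' 2 (i * n + j) = 0"
        using out by (auto simp: mm_output_def holds_matrix_def)
      ultimately have "arrs s' 2 (q div n * n + q mod n) = 0"
        by blast
      then show ?thesis
        by simp
    qed
    then have "{..<n\<^sup>2} \<subseteq> {i. arrs s' 2 i \<noteq> arrs s 2 i}"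
      by (auto simp: s_def)
    then have "n\<^sup>2 \<le> t"
      using exec_changed_cells[OF ex, of 2] card_mono[of "{i. arrs s' 2 i \<noteq> arrs s 2 i}" "{..<n\<^sup>2}"]
      by simp
    then show ?thesis using t by simp
  qed
  \<comment> \<open>Chaining the lower bound with the bound on \<open>T\<close> compares two powers
    of \<open>n\<close>; as \<open>n\<close> tends to infinity, the exponents compare as
    well.\<close>
  have "(\<lambda>n. real n powr 2) \<in> O(\<lambda>n. real (T n))"
  proof (rule landau_o.big_mono, rule eventually_mono[OF eventually_gt_at_top[of 0]])
    fix n :: nat
    assume "0 < n"
    have "(real n)\<^sup>2 \<le> real (T n)"
      using ge[of n] by (metis of_nat_le_iff of_nat_power)
    with \<open>0 < n\<close> show "norm (real n powr 2) \<le> norm (real (T n))"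
      by (simp add: powr_numeral)
  qed
  also note T
  finally show ?thesis
    by (subst (asm) powr_bigo_iff) (auto simp: filterlim_real_sequentially)
qed

text \<open>A total-correctness triple with a time budget. \<open>word_state\<close> is both
  presupposed and delivered, so it passes through compositions without entering every
  assertion.\<close>

definition run :: "nat \<Rightarrow> com \<Rightarrow> state \<Rightarrow> nat \<Rightarrow> (state \<Rightarrow> bool) \<Rightarrow> bool" where
  "run w c s T Q \<longleftrightarrow>
     (word_state w s \<longrightarrow> (\<exists>t s'. exec w c s t s' \<and> t \<le> T \<and> word_state w s' \<and> Q s'))"

section \<open>Rules for commands and loops with time budgets\<close>

lemma run_conseq:
  assumes "run w c s T Q" "T \<le> T'" "\<And>s'. word_state w s' \<Longrightarrow> Q s' \<Longrightarrow> Q' s'"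
  shows "run w c s T' Q'"
  using assms unfolding run_def by (meson order_trans)

lemma run_exec:
  assumes "exec w c s t s'" "t \<le> T" "Q s'"
  shows "run w c s T Q"
  using assms exec_word_state unfolding run_def by blast

lemma run_Assign:
  assumes "eval w s e = Some v" "cost e + 1 \<le> T" "Q (s\<lparr>regs := (regs s)(x := v)\<rparr>)"
  shows "run w (Assign x e) s T Q"
  using exec.Assign[OF assms(1)] assms(2,3) by (rule run_exec)

lemma run_Store:
  assumes "eval w s e1 = Some (int i)" "eval w s e2 = Some v" "cost e1 + cost e2 + 1 \<le> T"
    and "Q (s\<lparr>arrs := (arrs s)(a := (arrs s a)(i := v))\<rparr>)"
  shows "run w (Store a e1 e2) s T Q"
  using exec.Store[OF assms(1) _ assms(2), of a] assms(3,4) by (intro run_exec) auto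

text \<open>Continuation style: the postcondition of the first command is itself a
  \<open>run\<close> statement, so no intermediate assertion has to be named.\<close>

lemma run_Seq:
  assumes "run w c1 s T1 (\<lambda>s'. run w c2 s' T2 Q)" "T1 + T2 \<le> T"
  shows "run w (Seq c1 c2) s T Q"
  unfolding run_def
proof
  assume "word_state w s"
  with assms(1) obtain t1 s1 where 1: "exec w c1 s t1 s1" "t1 \<le> T1" "word_state w s1"
    and "run w c2 s1 T2 Q"
    unfolding run_def by blast
  then obtain t2 s2 where 2: "exec w c2 s1 t2 s2" "t2 \<le> T2" "word_state w s2" "Q s2"
    unfolding run_def by blast
  have "exec w (Seq c1 c2) s (t1 + t2) s2" "t1 + t2 \<le> T"
    using 1 2 assms(2) by (auto intro: exec.Seq)
  with 2 show "\<exists>t s'. exec w (Seq c1 c2) s t s' \<and> t \<le> T \<and> word_state w s' \<and> Q s'"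
    by blast
qed

lemma run_Seq':
  assumes "run w c1 s T1 R" "\<And>s'. R s' \<Longrightarrow> run w c2 s' T2 Q" "T1 + T2 \<le> T"
  shows "run w (Seq c1 c2) s T Q"
proof (rule run_Seq)
  show "run w c1 s T1 (\<lambda>s'. run w c2 s' T2 Q)"
    using assms(1) order_refl assms(2) by (rule run_conseq)
qed fact

lemma run_While_True:
  assumes "eval w s e = Some v" "v \<noteq> 0"
    and "run w c s T1 (\<lambda>s'. run w (While e c) s' T2 Q)" "cost e + 1 + T1 + T2 \<le> T"
  shows "run w (While e c) s T Q"
  unfolding run_def
proof
  assume "word_state w s"
  with assms(3) obtain t1 s1 where 1: "exec w c s t1 s1" "t1 \<le> T1" "word_state w s1"
    and "run w (While e c) s1 T2 Q"
    unfolding run_def by blast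
  then obtain t2 s2 where 2: "exec w (While e c) s1 t2 s2" "t2 \<le> T2" "word_state w s2" "Q s2"
    unfolding run_def by blast
  have "exec w (While e c) s (cost e + 1 + t1 + t2) s2" "cost e + 1 + t1 + t2 \<le> T"
    using 1 2 assms by (auto intro: exec.WhileTrue simp del: One_nat_def)
  with 2 show "\<exists>t s'. exec w (While e c) s t s' \<and> t \<le> T \<and> word_state w s' \<and> Q s'"
    by blast
qed

definition loop :: "nat \<Rightarrow> expr \<Rightarrow> com \<Rightarrow> com" where
  "loop r e c = Seq (Assign r (Const 0))
     (While (Op Less (Reg r) e) (Seq c (Assign r (Op Add (Reg r) (Const 1)))))"

text \<open>The body has to leave the counter at \<open>i\<close>, and the invariant is demanded
  only after the increment. The limit is evaluated anew in every round, so it must be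
  \<open>m\<close> whenever the invariant holds; \<open>fit\<close> keeps the counter from
  overflowing. The induction is on the remaining rounds, where test and increment cost at most
  \<open>cost e + 8\<close>.\<close>

lemma run_loop:
  assumes step: "\<And>i s. i < m \<Longrightarrow> Inv i s \<Longrightarrow> regs s r = int i \<Longrightarrow>
      run w c s T (\<lambda>s'. regs s' r = int i \<and> Inv (Suc i) (s'\<lparr>regs := (regs s')(r := int i + 1)\<rparr>))"
    and limit: "\<And>i s. Inv i s \<Longrightarrow> eval w s e = Some (int m)"
    and fit: "fits w 1" "fits w (int m)"
    and init: "Inv 0 (s\<lparr>regs := (regs s)(r := 0)\<rparr>)"
  shows "run w (loop r e c) s ((T + cost e + 10) * (m + 1)) (Inv m)"
proof -
  let ?W = "While (Op Less (Reg r) e) (Seq c (Assign r (Op Add (Reg r) (Const 1))))"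
  have while: "run w ?W s ((T + cost e + 8) * (m - i + 1)) (Inv m)"
    if "i \<le> m" "Inv i s" "regs s r = int i" for i s
    using that
  proof (induction "m - i" arbitrary: i s)
    case 0
    then have i: "i = m" by simp
    with 0 have "eval w s (Op Less (Reg r) e) = Some 0"
      by (simp add: limit word_def)
    from exec.WhileFalse[OF this] show ?case
      using 0 i by (auto intro!: run_exec[where t = "cost (Op Less (Reg r) e) + 1"])
  next
    case (Suc d)
    then have lt: "i < m" and d: "m - i = Suc d" "d = m - Suc i" by simp_all
    have ev: "eval w s (Op Less (Reg r) e) = Some 1"
      using Suc.prems lt fit by (simp add: limit word_def)
    show ?case
    proof (rule run_While_True[OF ev])
      show "run w (Seq c (Assign r (Op Add (Reg r) (Const 1)))) s (T + 4)
          (\<lambda>s'. run w ?W s' ((T + cost e + 8) * (m - Suc i + 1)) (Inv m))"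
      proof (rule run_Seq)
        show "run w c s T (\<lambda>s'. run w (Assign r (Op Add (Reg r) (Const 1))) s' 4
            (\<lambda>s'. run w ?W s' ((T + cost e + 8) * (m - Suc i + 1)) (Inv m)))"
        proof (rule run_conseq[OF step[OF lt Suc.prems(2,3)] order_refl])
          fix s' assume s': "regs s' r = int i \<and> Inv (Suc i) (s'\<lparr>regs := (regs s')(r := int i + 1)\<rparr>)"
          have "fits w (int i + 1)"
            using fit lt unfolding fits_def by linarith
          then show "run w (Assign r (Op Add (Reg r) (Const 1))) s' 4
            (\<lambda>s'. run w ?W s' ((T + cost e + 8) * (m - Suc i + 1)) (Inv m))"
            using s' fit lt d by (intro run_Assign[where v = "int i + 1"] Suc.hyps(1)) (auto simp: word_def)
        qed
      qed simp
    qed (use d in simp_all)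
  qed
  show ?thesis
    unfolding loop_def
  proof (rule run_Seq)
    show "run w (Assign r (Const 0)) s 2 (\<lambda>s'. run w ?W s' ((T + cost e + 8) * (m - 0 + 1)) (Inv m))"
      by (rule run_Assign[where v = 0]; (rule while)?) (auto simp: word_def init)
    show "2 + (T + cost e + 8) * (m - 0 + 1) \<le> (T + cost e + 10) * (m + 1)"
      by (simp add: algebra_simps)
  qed
qed

text \<open>\<open>val\<close> is required in every state that agrees with \<open>s\<close> outside
  register \<open>r\<close> and array \<open>a\<close>, so cells already overwritten cannot
  influence later values.\<close>

lemma run_loop_Store:
  assumes val: "\<And>i s'. i < m \<Longrightarrow> regs s' r = int i \<Longrightarrow> \<forall>x. x \<noteq> r \<longrightarrow> regs s' x = regs s x \<Longrightarrow>
      \<forall>b. b \<noteq> a \<longrightarrow> arrs s' b = arrs s b \<Longrightarrow> eval w s' e = Some (v i)"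
    and limit: "\<And>s'. \<forall>x. x \<noteq> r \<longrightarrow> regs s' x = regs s x \<Longrightarrow> eval w s' l = Some (int m)"
    and fit: "fits w 1" "fits w (int m)"
  shows "run w (loop r l (Store a (Reg r) e)) s ((cost e + cost l + 12) * (m + 1))
    (\<lambda>s'. (\<forall>x. x \<noteq> r \<longrightarrow> regs s' x = regs s x) \<and> (\<forall>b. b \<noteq> a \<longrightarrow> arrs s' b = arrs s b) \<and>
      (\<forall>i<m. arrs s' a i = v i))"
proof -
  define Inv where "Inv j s' \<longleftrightarrow> (\<forall>x. x \<noteq> r \<longrightarrow> regs s' x = regs s x) \<and>
      (\<forall>b. b \<noteq> a \<longrightarrow> arrs s' b = arrs s b) \<and> (\<forall>i<j. arrs s' a i = v i)" for j and s' :: state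
  have "run w (loop r l (Store a (Reg r) e)) s ((cost e + 2 + cost l + 10) * (m + 1)) (Inv m)"
  proof (rule run_loop)
    show "run w (Store a (Reg r) e) s' (cost e + 2)
        (\<lambda>s'. regs s' r = int i \<and> Inv (Suc i) (s'\<lparr>regs := (regs s')(r := int i + 1)\<rparr>))"
      if "i < m" "Inv i s'" "regs s' r = int i" for i s'
      by (rule run_Store[where i = i and v = "v i"])
        (use that in \<open>auto simp: Inv_def less_Suc_eq intro: val\<close>)
  qed (use limit fit in \<open>auto simp: Inv_def\<close>)
  then show ?thesis
    by (rule run_conseq) (auto simp: Inv_def)
qed

section \<open>Splitting outerplanar patterns\<close>

datatype point = First | Second | Guess nat

text \<open>Conditions are kept as syntax so that they can be interpreted over any graph and also
  compiled to expressions.\<close>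

datatype atom = Before point point | Same point point | Edge point point | Nonedge point point

fun point_val :: "nat \<Rightarrow> nat \<Rightarrow> nat \<Rightarrow> nat \<Rightarrow> point \<Rightarrow> nat" where
  "point_val n g x y First = x"
| "point_val n g x y Second = y"
| "point_val n g x y (Guess j) = g div n ^ j mod n"

fun atom_val :: "nat \<Rightarrow> (nat \<Rightarrow> nat \<Rightarrow> bool) \<Rightarrow> nat \<Rightarrow> nat \<Rightarrow> nat \<Rightarrow> atom \<Rightarrow> bool" where
  "atom_val n adj g x y (Before p q) \<longleftrightarrow> point_val n g x y p < point_val n g x y q"
| "atom_val n adj g x y (Same p q) \<longleftrightarrow> point_val n g x y p = point_val n g x y q"
| "atom_val n adj g x y (Edge p q) \<longleftrightarrow> adj (point_val n g x y p) (point_val n g x y q)"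
| "atom_val n adj g x y (Nonedge p q) \<longleftrightarrow> \<not> adj (point_val n g x y p) (point_val n g x y q)"

abbreviation atoms_val ::
    "nat \<Rightarrow> (nat \<Rightarrow> nat \<Rightarrow> bool) \<Rightarrow> nat \<Rightarrow> nat \<Rightarrow> nat \<Rightarrow> atom list \<Rightarrow> bool" where
  "atoms_val n adj g x y as \<equiv> list_all (atom_val n adj g x y) as"

text \<open>The tree of interval splits. It depends on the pattern alone, so one program serves all
  \<open>n\<close>, graphs and guesses. A \<open>Join\<close> stands for a Boolean matrix product
  masked by its atoms.\<close>

datatype plan = Base "atom list" | Join "atom list" plan plan

fun plan_val :: "nat \<Rightarrow> (nat \<Rightarrow> nat \<Rightarrow> bool) \<Rightarrow> nat \<Rightarrow> plan \<Rightarrow> nat \<Rightarrow> nat \<Rightarrow> bool" where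
  "plan_val n adj g (Base as) x y \<longleftrightarrow> atoms_val n adj g x y as"
| "plan_val n adj g (Join as l r) x y \<longleftrightarrow>
     atoms_val n adj g x y as \<and> (\<exists>z<n. plan_val n adj g l x z \<and> plan_val n adj g r z y)"

text \<open>Base-\<open>n\<close> expansion, with each new digit added at the low end. It lets a
  single loop counter run through all tuples of guessed positions.\<close>

lemma digits_exist:
  fixes n :: nat
  assumes "\<forall>j<m. f j < n"
  shows "\<exists>g<n ^ m. \<forall>j<m. g div n ^ j mod n = f j"
  using assms
proof (induction m arbitrary: f)
  case (Suc m)
  from Suc.IH[of "\<lambda>j. f (Suc j)"] Suc.prems
  obtain g where g: "g < n ^ m" "\<forall>j<m. g div n ^ j mod n = f (Suc j)"
    by auto
  have f0: "f 0 < n"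
    using Suc.prems by simp
  have "(f 0 + n * g) div n ^ j mod n = f j" if "j < Suc m" for j
    using that f0 g(2) by (cases j) (auto simp: div_mult2_eq)
  moreover have "f 0 + n * g < n ^ Suc m"
  proof -
    have "f 0 + n * g < n * Suc g"
      using f0 by simp
    also have "\<dots> \<le> n * n ^ m"
      using g(1) by (intro mult_le_mono) auto
    finally show ?thesis
      by simp
  qed
  ultimately show ?case
    by blast
qed simp

text \<open>
  An interval of the pattern is split at the largest \<open>m\<close> joined to its left end, so that no edge
  inside the interval other than the one between its ends passes over \<open>m\<close>.
\<close>

lemma plan_exists:
  fixes E :: "nat \<Rightarrow> nat \<Rightarrow> bool" and cond :: "nat \<Rightarrow> nat \<Rightarrow> atom list"
  assumes noncrossing: "\<And>a b a' b'. a < a' \<Longrightarrow> a' < b \<Longrightarrow> b < b' \<Longrightarrow> b' \<le> k \<Longrightarrow> E a b \<Longrightarrow> \<not> E a' b'"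
    and compose: "\<And>n adj g a m b x z y. a < m \<Longrightarrow> m < b \<Longrightarrow> \<not> E a b \<Longrightarrow>
      atoms_val n adj g x z (cond a m) \<Longrightarrow> atoms_val n adj g z y (cond m b) \<Longrightarrow>
      atoms_val n adj g x y (cond a b)"
    and "i < j" "j \<le> k"
  shows "\<exists>t. \<forall>n adj g x y. plan_val n adj g t x y \<longleftrightarrow>
    (\<exists>p. p i = x \<and> p j = y \<and> (\<forall>a. i < a \<and> a < j \<longrightarrow> p a < n) \<and>
      (\<forall>a b. i \<le> a \<and> a < b \<and> b \<le> j \<longrightarrow> atoms_val n adj g (p a) (p b) (cond a b)))"
  using \<open>i < j\<close> \<open>j \<le> k\<close>
proof (induction "j - i" arbitrary: i j rule: less_induct)
  case less
  show ?case
  proof (cases "j = Suc i")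
    case True
    have "plan_val n adj g (Base (cond i j)) x y \<longleftrightarrow>
      (\<exists>p. p i = x \<and> p j = y \<and> (\<forall>a. i < a \<and> a < j \<longrightarrow> p a < n) \<and>
        (\<forall>a b. i \<le> a \<and> a < b \<and> b \<le> j \<longrightarrow> atoms_val n adj g (p a) (p b) (cond a b)))"
      (is "?L \<longleftrightarrow> ?R") for n adj g x y
    proof
      assume ?L
      then show ?R
        using True by (intro exI[of _ "\<lambda>a. if a = i then x else y"]) (auto simp: le_Suc_eq)
    qed (use True in auto)
    then show ?thesis
      by blast
  next
    case False
    with less.prems have gap: "Suc i < j" by simp
    \<comment> \<open>Adding \<open>Suc i\<close> makes the maximum exist. If \<open>m\<close> is
      \<open>Suc i\<close>, nothing lies strictly between \<open>i\<close> and
      \<open>m\<close>.\<close>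
    define B where "B = insert (Suc i) {m. i < m \<and> m < j \<and> E i m}"
    have fin: "finite B" "B \<noteq> {}"
      by (auto simp: B_def)
    define m where "m = Max B"
    have "m \<in> B" and max: "\<And>b. b \<in> B \<Longrightarrow> b \<le> m"
      using fin by (simp_all add: m_def)
    with gap have m: "i < m" "m < j" "m = Suc i \<or> E i m"
      by (auto simp: B_def)
    \<comment> \<open>An edge from \<open>i\<close> over \<open>m\<close> to an inner vertex
      contradicts the maximality of \<open>m\<close>. An edge over \<open>m\<close> from a later
      vertex rules out \<open>m = Suc i\<close>, so \<open>E i m\<close> holds and the two edges
      cross.\<close>
    have over: "\<not> E a b" if "i \<le> a" "a < m" "m < b" "b \<le> j" "a \<noteq> i \<or> b \<noteq> j" for a b
    proof
      assume E: "E a b"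
      show False
      proof (cases "a = i")
        case True
        with that E max[of b] show False
          by (auto simp: B_def)
      next
        case False
        with that m have "E i m" "i < a"
          by auto
        with noncrossing[of i a m b] that E less.prems show False
          by auto
      qed
    qed
    have sizes: "m - i < j - i" "j - m < j - i" "m \<le> k"
      using m less.prems by auto
    obtain l where l: "\<And>n adj g x y. plan_val n adj g l x y \<longleftrightarrow>
      (\<exists>p. p i = x \<and> p m = y \<and> (\<forall>a. i < a \<and> a < m \<longrightarrow> p a < n) \<and>
        (\<forall>a b. i \<le> a \<and> a < b \<and> b \<le> m \<longrightarrow> atoms_val n adj g (p a) (p b) (cond a b)))"
      using less.hyps[OF sizes(1) m(1) sizes(3)] by blast
    obtain r where r: "\<And>n adj g x y. plan_val n adj g r x y \<longleftrightarrow>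
      (\<exists>p. p m = x \<and> p j = y \<and> (\<forall>a. m < a \<and> a < j \<longrightarrow> p a < n) \<and>
        (\<forall>a b. m \<le> a \<and> a < b \<and> b \<le> j \<longrightarrow> atoms_val n adj g (p a) (p b) (cond a b)))"
      using less.hyps[OF sizes(2) m(2) less.prems(2)] by blast
    have "plan_val n adj g (Join (cond i j) l r) x y \<longleftrightarrow>
      (\<exists>p. p i = x \<and> p j = y \<and> (\<forall>a. i < a \<and> a < j \<longrightarrow> p a < n) \<and>
        (\<forall>a b. i \<le> a \<and> a < b \<and> b \<le> j \<longrightarrow> atoms_val n adj g (p a) (p b) (cond a b)))"
      (is "?L \<longleftrightarrow> ?R") for n adj g x y
    proof
      assume ?L
      then obtain z where z: "z < n" and c: "atoms_val n adj g x y (cond i j)"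
        and "plan_val n adj g l x z" "plan_val n adj g r z y"
        by auto
      from this(3,4) obtain p q where p: "p i = x" "p m = z" "\<And>a. i < a \<Longrightarrow> a < m \<Longrightarrow> p a < n"
          "\<And>a b. i \<le> a \<Longrightarrow> a < b \<Longrightarrow> b \<le> m \<Longrightarrow> atoms_val n adj g (p a) (p b) (cond a b)"
        and q: "q m = z" "q j = y" "\<And>a. m < a \<Longrightarrow> a < j \<Longrightarrow> q a < n"
          "\<And>a b. m \<le> a \<Longrightarrow> a < b \<Longrightarrow> b \<le> j \<Longrightarrow> atoms_val n adj g (q a) (q b) (cond a b)"
        unfolding l r by auto
      define f where "f a = (if a \<le> m then p a else q a)" for a
      have f: "f a = q a" if "m \<le> a" for a
        using that p(2) q(1) by (cases "a = m") (auto simp: f_def)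
      have "atoms_val n adj g (f a) (f b) (cond a b)" if ab: "i \<le> a" "a < b" "b \<le> j" for a b
      proof -
        \<comment> \<open>A pair on one side of \<open>m\<close> is covered by a subinterval, the
          pair of ends by the mask \<open>c\<close>. Any other pair straddles \<open>m\<close> and
          is no edge by \<open>over\<close>, so its condition is composed from those of
          \<open>(a, m)\<close> and \<open>(m, b)\<close>.\<close>
        consider "b \<le> m" | "m \<le> a" | "a = i" "b = j" | "a < m" "m < b" "a \<noteq> i \<or> b \<noteq> j"
          by linarith
        then show ?thesis
        proof cases
          case 1
          then show ?thesis using p(4) ab by (simp add: f_def)
        next
          case 2
          then show ?thesis using q(4) ab by (simp add: f)
        next
          case 3
          then show ?thesis using c p(1) q(2) m by (simp add: f_def)
        next
          case 4
          then have "atoms_val n adj g (p a) (p m) (cond a m)" "atoms_val n adj g (q m) (q b) (cond m b)"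
            using p(4) q(4) ab m by auto
          then have "atoms_val n adj g (p a) (q b) (cond a b)"
            using compose[of a m b] 4 over[of a b] ab p(2) q(1) by auto
          then show ?thesis using 4 by (simp add: f_def)
        qed
      qed
      moreover have "f i = x" "f j = y"
        using p(1) q(2) m by (auto simp: f_def)
      moreover have "f a < n" if "i < a" "a < j" for a
        using that p(2,3) q(3) z by (cases a m rule: linorder_cases) (auto simp: f_def)
      ultimately show ?R
        by (intro exI[of _ f]) auto
    next
      assume ?R
      then obtain p where p: "p i = x" "p j = y" "\<And>a. i < a \<Longrightarrow> a < j \<Longrightarrow> p a < n"
        "\<And>a b. i \<le> a \<Longrightarrow> a < b \<Longrightarrow> b \<le> j \<Longrightarrow> atoms_val n adj g (p a) (p b) (cond a b)"
        by auto
      have "plan_val n adj g l x (p m)" "plan_val n adj g r (p m) y"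
        unfolding l r using p m by (auto intro!: exI[of _ p])
      then show ?L
        using p m by auto
    qed
    then show ?thesis
      by blast
  qed
qed

text \<open>Pattern vertices become their ranks and graph vertices their positions in the ordering,
  so order preservation is monotonicity of \<open>p\<close> and pairs are read for
  \<open>a < b\<close> only.\<close>

definition embeds ::
    "nat \<Rightarrow> (nat \<Rightarrow> nat \<Rightarrow> bool) \<Rightarrow> (nat \<Rightarrow> nat \<Rightarrow> bool) \<Rightarrow> nat \<Rightarrow> (nat \<Rightarrow> nat \<Rightarrow> bool) \<Rightarrow> (nat \<Rightarrow> nat) \<Rightarrow> bool"
  where
  "embeds k M F n adj p \<longleftrightarrow> (\<forall>a<k. p a < n) \<and>
     (\<forall>a b. a < b \<and> b < k \<longrightarrow> p a < p b \<and> (M a b \<longrightarrow> adj (p a) (p b)) \<and> (F a b \<longrightarrow> \<not> adj (p a) (p b)))"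

text \<open>Once the ends of the removed edges are guessed, their adjacency constraints mention only
  digits and are tested separately in \<open>sc\<close>. The other edges \<open>E\<close> do not
  cross, so \<open>plan_exists\<close> applies, with \<open>Same\<close> atoms tying the plan to the
  guess.\<close>

lemma plan_for_guessed_edges:
  fixes M F :: "nat \<Rightarrow> nat \<Rightarrow> bool" and A B :: "nat \<Rightarrow> nat"
  assumes "2 \<le> k"
    and AB: "\<And>i. i < d \<Longrightarrow> A i < B i \<and> B i < k"
    and noncrossing: "\<And>a b a' b'. a < a' \<Longrightarrow> a' < b \<Longrightarrow> b < b' \<Longrightarrow> b' < k \<Longrightarrow>
      M a b \<or> F a b \<Longrightarrow> M a' b' \<or> F a' b' \<Longrightarrow>
      \<exists>i<d. (A i = a \<and> B i = b) \<or> (A i = a' \<and> B i = b')"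
  shows "\<exists>sc t. \<forall>n adj. (\<exists>p. embeds k M F n adj p) \<longleftrightarrow>
    (\<exists>g<n ^ (2 * d). \<exists>x<n. \<exists>y<n. plan_val n adj g t x y \<and> atoms_val n adj g x y sc)"
proof -
  define E where "E a b \<longleftrightarrow> (M a b \<or> F a b) \<and> (\<forall>i<d. A i \<noteq> a \<or> B i \<noteq> b)" for a b
  text \<open>The guessed digits \<open>2 * i\<close> and \<open>2 * i + 1\<close> are the positions of the ends of the \<open>i\<close>-th removed edge.\<close>
  define U where "U j = (if even j then A (j div 2) else B (j div 2))" for j
  \<comment> \<open>The digit constraints are attached to both ends of every pair. So they survive
    when a non-edge \<open>(a, b)\<close> is composed from \<open>(a, m)\<close> and
    \<open>(m, b)\<close>, as the order does by transitivity.\<close>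
  define cond where "cond a b = Before First Second #
    (if E a b \<and> M a b then [Edge First Second] else []) @
    (if E a b \<and> F a b then [Nonedge First Second] else []) @
    map (\<lambda>j. Same First (Guess j)) (filter (\<lambda>j. U j = a) [0..<2 * d]) @
    map (\<lambda>j. Same Second (Guess j)) (filter (\<lambda>j. U j = b) [0..<2 * d])" for a b
  define sc where "sc =
    map (\<lambda>i. Edge (Guess (2 * i)) (Guess (2 * i + 1))) (filter (\<lambda>i. M (A i) (B i)) [0..<d]) @
    map (\<lambda>i. Nonedge (Guess (2 * i)) (Guess (2 * i + 1))) (filter (\<lambda>i. F (A i) (B i)) [0..<d])"
  have cond: "atoms_val n adj g x y (cond a b) \<longleftrightarrow> x < y \<and> (E a b \<and> M a b \<longrightarrow> adj x y) \<and>
      (E a b \<and> F a b \<longrightarrow> \<not> adj x y) \<and> (\<forall>j<2 * d. U j = a \<longrightarrow> x = g div n ^ j mod n) \<and>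
      (\<forall>j<2 * d. U j = b \<longrightarrow> y = g div n ^ j mod n)" for n adj g x y a b
    by (auto simp: cond_def list.pred_map list_all_iff[of _ "filter _ _"])
  have sc: "atoms_val n adj g x y sc \<longleftrightarrow> (\<forall>i<d.
      (M (A i) (B i) \<longrightarrow> adj (g div n ^ (2 * i) mod n) (g div n ^ (2 * i + 1) mod n)) \<and>
      (F (A i) (B i) \<longrightarrow> \<not> adj (g div n ^ (2 * i) mod n) (g div n ^ (2 * i + 1) mod n)))" for n adj g x y
    by (auto simp: sc_def list.pred_map list_all_iff[of _ "filter _ _"])
  have "\<exists>t. \<forall>n adj g x y. plan_val n adj g t x y \<longleftrightarrow>
    (\<exists>p. p 0 = x \<and> p (k - 1) = y \<and> (\<forall>a. 0 < a \<and> a < k - 1 \<longrightarrow> p a < n) \<and>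
      (\<forall>a b. 0 \<le> a \<and> a < b \<and> b \<le> k - 1 \<longrightarrow> atoms_val n adj g (p a) (p b) (cond a b)))"
  proof (rule plan_exists)
    show "\<not> E a' b'" if "a < a'" "a' < b" "b < b'" "b' \<le> k - 1" "E a b" for a b a' b'
    proof
      assume "E a' b'"
      moreover have "b' < k"
        using that \<open>2 \<le> k\<close> by simp
      ultimately show False
        using that noncrossing[of a a' b b'] unfolding E_def by metis
    qed
    show "atoms_val n adj g x y (cond a b)"
      if "\<not> E a b" "atoms_val n adj g x z (cond a m)" "atoms_val n adj g z y (cond m b)"
      for n adj g a m b x z y
      using that unfolding cond by auto
  qed (use \<open>2 \<le> k\<close> in auto)
  then obtain t where t: "\<And>n adj g x y. plan_val n adj g t x y \<longleftrightarrow>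
    (\<exists>p. p 0 = x \<and> p (k - 1) = y \<and> (\<forall>a. 0 < a \<and> a < k - 1 \<longrightarrow> p a < n) \<and>
      (\<forall>a b. a < b \<and> b \<le> k - 1 \<longrightarrow> atoms_val n adj g (p a) (p b) (cond a b)))"
    by auto
  have "(\<exists>p. embeds k M F n adj p) \<longleftrightarrow>
    (\<exists>g<n ^ (2 * d). \<exists>x<n. \<exists>y<n. plan_val n adj g t x y \<and> atoms_val n adj g x y sc)"
    (is "?L \<longleftrightarrow> ?R") for n adj
  proof
    assume ?L
    then obtain p where p: "\<And>a. a < k \<Longrightarrow> p a < n"
      "\<And>a b. a < b \<Longrightarrow> b < k \<Longrightarrow> p a < p b \<and> (M a b \<longrightarrow> adj (p a) (p b)) \<and> (F a b \<longrightarrow> \<not> adj (p a) (p b))"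
      by (auto simp: embeds_def)
    have U: "U j < k" if "j < 2 * d" for j
      using AB[of "j div 2"] that by (auto simp: U_def)
    then obtain g where g: "g < n ^ (2 * d)" "\<And>j. j < 2 * d \<Longrightarrow> g div n ^ j mod n = p (U j)"
      using digits_exist[of "2 * d" "\<lambda>j. p (U j)" n] p(1) by blast
    have "plan_val n adj g t (p 0) (p (k - 1))"
      unfolding t using p g(2) \<open>2 \<le> k\<close> by (intro exI[of _ p]) (auto simp: cond)
    moreover have "atoms_val n adj g (p 0) (p (k - 1)) sc"
      unfolding sc
    proof (intro allI impI)
      fix i assume "i < d"
      have "U (2 * i) = A i" "U (2 * i + 1) = B i"
        by (simp_all add: U_def)
      moreover have "2 * i < 2 * d" "2 * i + 1 < 2 * d"
        using \<open>i < d\<close> by simp_all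
      ultimately show
        "(M (A i) (B i) \<longrightarrow> adj (g div n ^ (2 * i) mod n) (g div n ^ (2 * i + 1) mod n)) \<and>
         (F (A i) (B i) \<longrightarrow> \<not> adj (g div n ^ (2 * i) mod n) (g div n ^ (2 * i + 1) mod n))"
        using p(2) AB[OF \<open>i < d\<close>] g(2) by metis
    qed
    moreover have "p 0 < n" "p (k - 1) < n"
      using p(1) \<open>2 \<le> k\<close> by auto
    ultimately show ?R
      using g(1) by blast
  next
    assume ?R
    then obtain g x y where xy: "x < n" "y < n" and "plan_val n adj g t x y"
      and s: "atoms_val n adj g x y sc"
      by blast
    then obtain p where p: "p 0 = x" "p (k - 1) = y" "\<And>a. 0 < a \<Longrightarrow> a < k - 1 \<Longrightarrow> p a < n"
      "\<And>a b. a < b \<Longrightarrow> b \<le> k - 1 \<Longrightarrow> atoms_val n adj g (p a) (p b) (cond a b)"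
      unfolding t by auto
    \<comment> \<open>The plan bounds only inner vertices; the bounds for the two ends come from the
      ranges of \<open>x\<close> and \<open>y\<close>.\<close>
    have "p a < n" if "a < k" for a
      using that p(1-3) xy by (cases "a = 0"; cases "a = k - 1"; force)
    moreover have "p a < p b \<and> (M a b \<longrightarrow> adj (p a) (p b)) \<and> (F a b \<longrightarrow> \<not> adj (p a) (p b))"
      if "a < b" "b < k" for a b
    proof -
      have c: "atoms_val n adj g (p a) (p b) (cond a b)"
        using that by (intro p) auto
      show ?thesis
      \<comment> \<open>A removed edge is checked by \<open>sc\<close> at the guessed positions,
        which \<open>cond\<close> identifies with those of its ends; any other pair is checked by
        \<open>cond\<close> directly.\<close>
      proof (cases "\<exists>i<d. A i = a \<and> B i = b")
        case True
        then obtain i where i: "i < d" "A i = a" "B i = b" by blast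
        then have "U (2 * i) = a" "U (2 * i + 1) = b"
          by (simp_all add: U_def)
        moreover have "2 * i < 2 * d" "2 * i + 1 < 2 * d"
          using \<open>i < d\<close> by simp_all
        ultimately have "p a = g div n ^ (2 * i) mod n" "p b = g div n ^ (2 * i + 1) mod n" "p a < p b"
          using c unfolding cond by metis+
        with s i show ?thesis
          unfolding sc by metis
      next
        case False
        with c show ?thesis
          unfolding cond E_def by auto
      qed
    qed
    ultimately show ?L
      by (auto simp: embeds_def)
  qed
  then show ?thesis
    by blast
qed

section \<open>Translating patterns and ordered graphs to ranks and positions\<close>

lemma nth_sorted_list_of_set_less:
  fixes A :: "'a::linorder set"
  assumes "a < b" "b < card A"
  shows "sorted_list_of_set A ! a < sorted_list_of_set A ! b"
  using sorted_wrt_nth_less[OF strict_sorted_list_of_set, of a b A] assms by simp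

text \<open>Forwards, \<open>p a\<close> is the position of the vertex that \<open>f\<close> sends
  to the \<open>a\<close>-th pattern vertex. Backwards, \<open>X\<close> is the image of the map
  taking \<open>a\<close> to \<open>ord ! p a\<close>, and \<open>f\<close> comes from inverting
  this map.\<close>

lemma contains_pattern_iff_embeds:
  fixes P :: "'a::linorder pattern"
  assumes P: "is_pattern P" and G: "is_ordered_graph G" "gverts G = {..<n}"
  defines "vs \<equiv> sorted_list_of_set (pverts P)"
  shows "contains_pattern G P \<longleftrightarrow> (\<exists>p. embeds (card (pverts P))
    (\<lambda>a b. {vs ! a, vs ! b} \<in> mandatory P) (\<lambda>a b. {vs ! a, vs ! b} \<in> forbidden P)
    n (\<lambda>x y. {gorder G ! x, gorder G ! y} \<in> gedges G) p)"
    (is "?L \<longleftrightarrow> ?R")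
proof -
  define k where "k = card (pverts P)"
  define ord where "ord = gorder G"
  have vs: "set vs = pverts P" "distinct vs" "length vs = k"
    using P by (auto simp: vs_def is_pattern_def k_def)
  have vs_less: "vs ! a < vs ! b" if "a < b" "b < k" for a b
    using that unfolding vs_def k_def by (rule nth_sorted_list_of_set_less)
  have ord: "distinct ord" "set ord = {..<n}" "length ord = n"
    using G distinct_card[of ord] by (auto simp: is_ordered_graph_def ord_def)
  have before: "before G (ord ! i) (ord ! j) \<longleftrightarrow> i < j" if "i < n" "j < n" for i j
    using that ord unfolding before_def ord_def by (metis (no_types) less_trans nth_eq_iff_index_eq)
  \<comment> \<open>Containment also quantifies over \<open>x = y\<close>, where
    \<open>{x, y}\<close> is a singleton; no mandatory or forbidden pair has this form.\<close>
  have edge_card: "u \<noteq> v" if "{u, v} \<in> mandatory P \<or> {u, v} \<in> forbidden P" for u v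
  proof -
    have "{u, v} \<in> pairs (pverts P)"
      using that P unfolding is_pattern_def by blast
    then show ?thesis
      by (auto simp: pairs_def)
  qed
  show ?thesis
  proof
    assume ?L
    then obtain X f where X: "X \<subseteq> gverts G" and f: "bij_betw f X (pverts P)"
      and mono: "\<And>x y. x \<in> X \<Longrightarrow> y \<in> X \<Longrightarrow> before G x y \<Longrightarrow> f x < f y"
      and mand: "\<And>x y. x \<in> X \<Longrightarrow> y \<in> X \<Longrightarrow> {f x, f y} \<in> mandatory P \<Longrightarrow> {x, y} \<in> gedges G"
      and forb: "\<And>x y. x \<in> X \<Longrightarrow> y \<in> X \<Longrightarrow> {f x, f y} \<in> forbidden P \<Longrightarrow> {x, y} \<notin> gedges G"
      unfolding contains_pattern_def by blast
    have "\<exists>i. i < n \<and> ord ! i \<in> X \<and> f (ord ! i) = vs ! a" if "a < k" for a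
    proof -
      have "vs ! a \<in> f ` X"
        using that vs f by (metis bij_betw_imp_surj_on nth_mem)
      then obtain x where x: "x \<in> X" "f x = vs ! a" by auto
      with X G(2) ord obtain i where "i < n" "ord ! i = x"
        by (metis in_set_conv_nth subsetD)
      with x show ?thesis by auto
    qed
    then obtain p where p: "\<And>a. a < k \<Longrightarrow> p a < n \<and> ord ! p a \<in> X \<and> f (ord ! p a) = vs ! a"
      by metis
    have "p a < p b" if "a < b" "b < k" for a b
    \<comment> \<open>Positions differ because the pattern vertices do; a reversed pair of positions
      would make \<open>f\<close> order its values contrary to \<open>vs\<close>.\<close>
    proof (rule ccontr)
      assume "\<not> p a < p b"
      moreover have "p a \<noteq> p b"
        using p[of a] p[of b] that vs_less[of a b] by auto
      ultimately have "before G (ord ! p b) (ord ! p a)"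
        using before p that by auto
      then have "vs ! b < vs ! a"
        using mono p that by (metis less_trans)
      with vs_less[OF that] show False by simp
    qed
    moreover have "{ord ! p a, ord ! p b} \<in> gedges G"
      if "{vs ! a, vs ! b} \<in> mandatory P" "a < b" "b < k" for a b
      using that p[of a] p[of b] mand[of "ord ! p a" "ord ! p b"] by auto
    moreover have "{ord ! p a, ord ! p b} \<notin> gedges G"
      if "{vs ! a, vs ! b} \<in> forbidden P" "a < b" "b < k" for a b
      using that p[of a] p[of b] forb[of "ord ! p a" "ord ! p b"] by auto
    ultimately show ?R
      using p unfolding embeds_def k_def ord_def by blast
  next
    assume ?R
    then obtain p where p: "\<And>a. a < k \<Longrightarrow> p a < n"
      and mono: "\<And>a b. a < b \<Longrightarrow> b < k \<Longrightarrow> p a < p b"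
      and mand: "\<And>a b. a < b \<Longrightarrow> b < k \<Longrightarrow> {vs ! a, vs ! b} \<in> mandatory P \<Longrightarrow>
        {ord ! p a, ord ! p b} \<in> gedges G"
      and forb: "\<And>a b. a < b \<Longrightarrow> b < k \<Longrightarrow> {vs ! a, vs ! b} \<in> forbidden P \<Longrightarrow>
        {ord ! p a, ord ! p b} \<notin> gedges G"
      unfolding embeds_def k_def ord_def by blast
    define h where "h a = ord ! p a" for a
    have inj: "inj_on h {..<k}"
    proof (rule linorder_inj_onI)
      fix a b assume "a < b" "a \<in> {..<k}" "b \<in> {..<k}"
      then show "h a \<noteq> h b"
        using mono[of a b] p[of a] p[of b] ord by (auto simp: h_def nth_eq_iff_index_eq)
    qed auto
    define X where "X = h ` {..<k}"
    define f where "f x = vs ! inv_into {..<k} h x" for x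
    have f: "f (h a) = vs ! a" if "a < k" for a
      using that inj by (simp add: f_def)
    have "bij_betw (\<lambda>a. vs ! a) {..<k} (pverts P)"
      using bij_betw_nth[OF vs(2)] vs by auto
    moreover have "bij_betw (inv_into {..<k} h) X {..<k}"
      unfolding X_def by (intro bij_betw_inv_into inj_on_imp_bij_betw inj)
    ultimately have bij: "bij_betw f X (pverts P)"
      unfolding f_def by (rule bij_betw_trans[unfolded comp_def, rotated])
    moreover have "X \<subseteq> gverts G"
      using p ord G(2) by (auto simp: X_def h_def)
    moreover have "card X = card (pverts P)"
      using bij by (rule bij_betw_same_card)
    moreover have "f x < f y" if "x \<in> X" "y \<in> X" "before G x y" for x y
    proof -
      obtain a b where ab: "a < k" "b < k" "x = h a" "y = h b"
        using \<open>x \<in> X\<close> \<open>y \<in> X\<close> by (auto simp: X_def)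
      then have "p a < p b"
        using that(3) before p by (simp add: h_def)
      then have "a < b"
        using mono[of b a] ab by (cases a b rule: linorder_cases) auto
      then show ?thesis
        using ab f vs_less by simp
    qed
    moreover have "{x, y} \<in> gedges G" if "x \<in> X" "y \<in> X" "{f x, f y} \<in> mandatory P" for x y
    proof -
      obtain a b where ab: "a < k" "b < k" "x = h a" "y = h b"
        using \<open>x \<in> X\<close> \<open>y \<in> X\<close> by (auto simp: X_def)
      with that(3) have e: "{vs ! a, vs ! b} \<in> mandatory P"
        by (simp add: f)
      with edge_card have "a \<noteq> b" by blast
      then show ?thesis
        using mand[of a b] mand[of b a] ab e by (cases a b rule: linorder_cases) (auto simp: h_def insert_commute)
    qed
    moreover have "{x, y} \<notin> gedges G" if "x \<in> X" "y \<in> X" "{f x, f y} \<in> forbidden P" for x y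
    proof -
      obtain a b where ab: "a < k" "b < k" "x = h a" "y = h b"
        using \<open>x \<in> X\<close> \<open>y \<in> X\<close> by (auto simp: X_def)
      with that(3) have e: "{vs ! a, vs ! b} \<in> forbidden P"
        by (simp add: f)
      with edge_card have "a \<noteq> b" by blast
      then show ?thesis
        using forb[of a b] forb[of b a] ab e by (cases a b rule: linorder_cases) (auto simp: h_def insert_commute)
    qed
    ultimately show ?L
      unfolding contains_pattern_def by (intro exI[of _ X] exI[of _ f] conjI ballI impI) simp_all
  qed
qed

text \<open>Removing all edges leaves an outerplanar pattern, so the minimum is over a nonempty set
  and is attained.\<close>

lemma dist_out_witness:
  assumes "is_pattern P"
  obtains S where "S \<subseteq> pedges P" "card S = dist_out P" "outerplanar (remove_edges P S)"
proof -
  have "outerplanar (remove_edges P (pedges P))"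
    by (auto simp: outerplanar_def remove_edges_def pedges_def)
  then have "\<exists>d S. S \<subseteq> pedges P \<and> card S = d \<and> outerplanar (remove_edges P S)"
    by blast
  from LeastI_ex[OF this] show thesis
    using that unfolding dist_out_def by blast
qed

text \<open>The removed edges are listed by the ranks \<open>A i < B i\<close> of their ends. Of two
  crossing edges at least one has been removed, which is the noncrossing hypothesis of
  \<open>plan_for_guessed_edges\<close>.\<close>

lemma plan_for_pattern:
  fixes P :: "'a::linorder pattern"
  assumes P: "is_pattern P" and k: "2 \<le> card (pverts P)"
  shows "\<exists>sc t. \<forall>n G. is_ordered_graph G \<longrightarrow> gverts G = {..<n} \<longrightarrow>
    (contains_pattern G P \<longleftrightarrow> (\<exists>g<n ^ (2 * dist_out P). \<exists>x<n. \<exists>y<n.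
      plan_val n (\<lambda>x y. {gorder G ! x, gorder G ! y} \<in> gedges G) g t x y \<and>
      atoms_val n (\<lambda>x y. {gorder G ! x, gorder G ! y} \<in> gedges G) g x y sc))"
proof -
  define k where "k = card (pverts P)"
  define vs where "vs = sorted_list_of_set (pverts P)"
  define d where "d = dist_out P"
  have vs: "set vs = pverts P" "distinct vs" "length vs = k"
    using P by (auto simp: vs_def is_pattern_def k_def)
  have vs_less: "vs ! a < vs ! b" if "a < b" "b < k" for a b
    using that unfolding vs_def k_def by (rule nth_sorted_list_of_set_less)
  obtain S where S: "S \<subseteq> pedges P" "card S = d" "outerplanar (remove_edges P S)"
    using dist_out_witness[OF P] unfolding d_def .
  have pedges: "pedges P \<subseteq> pairs (pverts P)"
    using P by (auto simp: is_pattern_def pedges_def)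
  have "finite S"
    using finite_subset[OF S(1)] finite_subset[OF pedges] P
    by (auto simp: is_pattern_def pairs_def)
  then obtain es where es: "set es = S" "length es = d"
    using S(2) finite_distinct_list distinct_card by metis
  have "\<exists>a b. a < b \<and> b < k \<and> es ! i = {vs ! a, vs ! b}" if "i < d" for i
  proof -
    have "es ! i \<in> pairs (pverts P)"
      using that es S(1) pedges by (metis nth_mem subsetD)
    then obtain u v where uv: "es ! i = {u, v}" "u \<noteq> v" "u \<in> set vs" "v \<in> set vs"
      by (auto simp: pairs_def card_2_iff vs)
    then obtain a b where ab: "a < k" "b < k" "u = vs ! a" "v = vs ! b"
      unfolding in_set_conv_nth vs(3) by blast
    with uv have "a \<noteq> b" by auto
    with ab uv show ?thesis
      by (cases a b rule: linorder_cases) (auto simp: insert_commute)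
  qed
  then obtain A B where AB: "\<And>i. i < d \<Longrightarrow> A i < B i \<and> B i < k \<and> es ! i = {vs ! A i, vs ! B i}"
    by metis
  define M F where "M a b \<longleftrightarrow> {vs ! a, vs ! b} \<in> mandatory P"
    and "F a b \<longleftrightarrow> {vs ! a, vs ! b} \<in> forbidden P" for a b
  have removed: "\<exists>i<d. A i = a \<and> B i = b" if "{vs ! a, vs ! b} \<in> S" "a < b" "b < k" for a b
  proof -
    obtain i where i: "i < d" "es ! i = {vs ! a, vs ! b}"
      using \<open>{vs ! a, vs ! b} \<in> S\<close> es by (metis in_set_conv_nth)
    with AB[of i] have "{vs ! A i, vs ! B i} = {vs ! a, vs ! b}" "A i < B i" "B i < k"
      by auto
    with that vs_less[of "A i" "B i"] vs_less[of a b] have "vs ! A i = vs ! a" "vs ! B i = vs ! b"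
      by (auto simp: doubleton_eq_iff)
    with that \<open>A i < B i\<close> \<open>B i < k\<close> vs have "A i = a" "B i = b"
      by (auto simp: nth_eq_iff_index_eq)
    with i show ?thesis by blast
  qed
  have "\<exists>i<d. (A i = a \<and> B i = b) \<or> (A i = a' \<and> B i = b')"
    if ord: "a < a'" "a' < b" "b < b'" "b' < k" and e: "M a b \<or> F a b" "M a' b' \<or> F a' b'" for a b a' b'
  proof -
    have "cross {vs ! a, vs ! b} {vs ! a', vs ! b'}"
      unfolding cross_def using vs_less ord by (metis less_trans)
    with S(3) e have "{vs ! a, vs ! b} \<in> S \<or> {vs ! a', vs ! b'} \<in> S"
      by (auto simp: outerplanar_def remove_edges_def pedges_def M_def F_def)
    then show ?thesis
      using removed[of a b] removed[of a' b'] ord by (meson less_trans)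
  qed
  then obtain sc t where t: "\<And>n adj. (\<exists>p. embeds k M F n adj p) \<longleftrightarrow>
    (\<exists>g<n ^ (2 * d). \<exists>x<n. \<exists>y<n. plan_val n adj g t x y \<and> atoms_val n adj g x y sc)"
    using plan_for_guessed_edges[of k d A B M F] AB k unfolding k_def by blast
  show ?thesis
  proof (intro exI allI impI)
    fix n and G :: "nat ordered_graph"
    assume G: "is_ordered_graph G" "gverts G = {..<n}"
    show "contains_pattern G P \<longleftrightarrow> (\<exists>g<n ^ (2 * dist_out P). \<exists>x<n. \<exists>y<n.
      plan_val n (\<lambda>x y. {gorder G ! x, gorder G ! y} \<in> gedges G) g t x y \<and>
      atoms_val n (\<lambda>x y. {gorder G ! x, gorder G ! y} \<in> gedges G) g x y sc)"
      using contains_pattern_iff_embeds[OF P G]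
      unfolding t[unfolded M_def F_def k_def vs_def] d_def .
  qed
qed

section \<open>The detection program\<close>

fun power_expr :: "nat \<Rightarrow> nat \<Rightarrow> expr" where
  "power_expr r 0 = Const 1"
| "power_expr r (Suc j) = Op Mul (Reg r) (power_expr r j)"

text \<open>
  The registers and arrays below \<open>N\<close> belong to the matrix multiplication. Register \<open>N\<close> holds \<open>n\<close>,
  \<open>N + 1\<close> the guess, whose digits in base \<open>n\<close> are positions, \<open>N + 2\<close> the answer and \<open>N + 3\<close>
  the current cell \<open>q\<close> of a matrix, in row \<open>q div n\<close> and column \<open>q mod n\<close>. Array \<open>N\<close> holds the
  adjacency matrix with respect to positions.
\<close>

fun point_expr :: "nat \<Rightarrow> point \<Rightarrow> expr" where
  "point_expr N First = Op Div (Reg (N + 3)) (Reg N)"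
| "point_expr N Second = Op Mod (Reg (N + 3)) (Reg N)"
| "point_expr N (Guess j) = Op Mod (Op Div (Reg (N + 1)) (power_expr N j)) (Reg N)"

fun atom_expr :: "nat \<Rightarrow> atom \<Rightarrow> expr" where
  "atom_expr N (Before p q) = Op Less (point_expr N p) (point_expr N q)"
| "atom_expr N (Same p q) = Op Eq (point_expr N p) (point_expr N q)"
| "atom_expr N (Edge p q) = Load N (Op Add (Op Mul (point_expr N p) (Reg N)) (point_expr N q))"
| "atom_expr N (Nonedge p q) =
     Op Eq (Load N (Op Add (Op Mul (point_expr N p) (Reg N)) (point_expr N q))) (Const 0)"

fun atoms_expr :: "nat \<Rightarrow> atom list \<Rightarrow> expr" where
  "atoms_expr N [] = Const 1"
| "atoms_expr N (a # as) = Op Mul (atom_expr N a) (atoms_expr N as)"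

text \<open>To extract digit \<open>j\<close> the program forms \<open>n ^ j\<close> as a word, so
  the highest digit in use enters the word length.\<close>

fun point_bound :: "point \<Rightarrow> nat" where
  "point_bound (Guess j) = j"
| "point_bound _ = 0"

fun atom_bound :: "atom \<Rightarrow> nat" where
  "atom_bound (Before p q) = max (point_bound p) (point_bound q)"
| "atom_bound (Same p q) = max (point_bound p) (point_bound q)"
| "atom_bound (Edge p q) = max (point_bound p) (point_bound q)"
| "atom_bound (Nonedge p q) = max (point_bound p) (point_bound q)"

fun atoms_bound :: "atom list \<Rightarrow> nat" where
  "atoms_bound [] = 0"
| "atoms_bound (a # as) = max (atom_bound a) (atoms_bound as)"

fun plan_bound :: "plan \<Rightarrow> nat" where
  "plan_bound (Base as) = atoms_bound as"
| "plan_bound (Join as l r) = max (atoms_bound as) (max (plan_bound l) (plan_bound r))"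

definition matrix_loop :: "nat \<Rightarrow> nat \<Rightarrow> expr \<Rightarrow> com" where
  "matrix_loop N a e = loop (N + 3) (power_expr N 2) (Store a (Reg (N + 3)) e)"

text \<open>The matrix of a plan is left in array \<open>b\<close>. The right subtree works from
  \<open>Suc b\<close> on, so the left factor survives. Register 0 is set afresh because an earlier
  run of \<open>mm\<close> may have overwritten it. The last loop turns the integer product back
  into zeros and ones under the mask.\<close>

fun compile :: "com \<Rightarrow> nat \<Rightarrow> nat \<Rightarrow> plan \<Rightarrow> com" where
  "compile mm N b (Base as) = matrix_loop N b (atoms_expr N as)"
| "compile mm N b (Join as l r) =
     Seq (compile mm N b l)
    (Seq (compile mm N (Suc b) r)
    (Seq (matrix_loop N 0 (Load b (Reg (N + 3))))
    (Seq (matrix_loop N 1 (Load (Suc b) (Reg (N + 3))))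
    (Seq (Assign 0 (Reg N))
    (Seq mm
    (matrix_loop N b (Op Mul (Op Less (Const 0) (Load 2 (Reg (N + 3)))) (atoms_expr N as))))))))"

text \<open>The factor in front of \<open>n * n + 1 + Tm\<close>, with generous constants: a
  \<open>Join\<close> pays for two copies, one multiplication and one masking.\<close>

fun plan_cost :: "nat \<Rightarrow> plan \<Rightarrow> nat" where
  "plan_cost N (Base as) = cost (atoms_expr N as) + 20"
| "plan_cost N (Join as l r) = plan_cost N l + plan_cost N r + cost (atoms_expr N as) + 100"

text \<open>The adjacency matrix is first rewritten from vertex names to positions. Then each guess
  leaves the matrix of the plan in array \<open>N + 1\<close>, whose cells are tested together with
  \<open>sc\<close> and collected by disjunction.\<close>

definition detect :: "com \<Rightarrow> nat \<Rightarrow> nat \<Rightarrow> plan \<Rightarrow> atom list \<Rightarrow> com" where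
  "detect mm N m t sc =
     Seq (Assign N (Reg 0))
    (Seq (matrix_loop N N
       (Load 0 (Op Add (Op Mul (Load 1 (point_expr N First)) (Reg N)) (Load 1 (point_expr N Second)))))
    (Seq (Assign (N + 2) (Const 0))
    (Seq (loop (N + 1) (power_expr N m)
       (Seq (compile mm N (N + 1) t)
         (loop (N + 3) (power_expr N 2)
           (Assign (N + 2) (Op Or (Reg (N + 2))
             (Op Mul (Load (N + 1) (Reg (N + 3))) (atoms_expr N sc)))))))
    (Assign 0 (Reg (N + 2))))))"

text \<open>One input size and one word length. The base \<open>n + 2\<close> in place of
  \<open>n\<close> makes the bound cover all \<open>n ^ j\<close> with \<open>j \<le> M\<close> even
  for \<open>n = 0\<close>. In \<open>multiply\<close> the exponent 0 means entries of absolute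
  value at most 1.\<close>

locale detection_machine =
  fixes w n N M Tm :: nat and adj :: "nat \<Rightarrow> nat \<Rightarrow> bool" and mm :: com
  assumes N: "3 \<le> N" "write_bound mm \<le> N"
    and M: "2 \<le> M" and word_length: "(n + 2) ^ M < 2 ^ w"
    and multiply: "\<And>x s. word_state w s \<Longrightarrow> mm_input 0 n x s \<Longrightarrow>
      \<exists>t s'. exec w mm s t s' \<and> t \<le> Tm \<and> mm_output n x s'"
begin

definition env :: "nat \<Rightarrow> state \<Rightarrow> bool" where
  "env g s \<longleftrightarrow> g \<le> n ^ M \<and> regs s N = int n \<and> regs s (N + 1) = int g \<and>
     (\<forall>q<n * n. arrs s N q = of_bool (adj (q div n) (q mod n)))"

text \<open>Register \<open>N + 3\<close> is the scratch cell counter and memory below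
  \<open>N\<close> belongs to the multiplication, so neither is protected.\<close>

definition keeps :: "nat \<Rightarrow> state \<Rightarrow> state \<Rightarrow> bool" where
  "keeps b s s' \<longleftrightarrow> (\<forall>x. N \<le> x \<and> x < N + 3 \<longrightarrow> regs s' x = regs s x) \<and>
     (\<forall>a. N \<le> a \<and> a < b \<longrightarrow> arrs s' a = arrs s a)"

lemma keeps_trans: "keeps b s s' \<Longrightarrow> keeps b' s' s'' \<Longrightarrow> b \<le> b' \<Longrightarrow> keeps b s s''"
  by (auto simp: keeps_def)

lemma env_keeps: "env g s \<Longrightarrow> keeps b s s' \<Longrightarrow> N < b \<Longrightarrow> env g s'"
  by (simp add: env_def keeps_def)

section \<open>Evaluation of the compiled expressions without overflow\<close>

lemma fits_nat:
  assumes "v \<le> (n + 2) ^ M"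
  shows "fits w (int v)"
proof -
  have "v < 2 ^ w"
    using assms word_length by (rule le_less_trans)
  then show ?thesis
    unfolding fits_def by (metis abs_of_nat of_nat_less_iff of_nat_numeral of_nat_power)
qed

lemma power_le: "j \<le> M \<Longrightarrow> n ^ j \<le> (n + 2) ^ M"
  using power_mono[of n "n + 2" j] power_increasing[of j M "n + 2"] by (simp add: order_trans)

lemma fits_1 [simp]: "fits w 1"
  using fits_nat[of 1] by simp

lemma fits_square: "v \<le> n * n \<Longrightarrow> fits w (int v)"
  using power_le[OF M] by (intro fits_nat) (simp add: power2_eq_square)

lemma fits_of_bool [simp]: "fits w (of_bool b)"
  by (cases b) auto

lemma fits_n: "v \<le> n \<Longrightarrow> fits w (int v)"
  by (rule fits_square) (use le_square[of n] in linarith)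

lemma eval_power:
  assumes "regs s N = int n" "j \<le> M"
  shows "eval w s (power_expr N j) = Some (int (n ^ j))"
  using assms(2)
proof (induction j)
  case (Suc j)
  then show ?case
    using fits_nat[OF power_le[OF Suc.prems]] assms(1) by (simp add: word_def)
qed (simp add: word_def)

lemma point_val_less: "q < n * n \<Longrightarrow> point_val n g (q div n) (q mod n) p < n"
  using less_square_div_mod[of q n] by (cases p) (auto intro!: mod_less_divisor)

lemma eval_point:
  assumes "env g s" "regs s (N + 3) = int q" "q < n * n" "point_bound p \<le> M"
  shows "eval w s (point_expr N p) = Some (int (point_val n g (q div n) (q mod n) p))"
proof -
  have fit: "fits w (int (point_val n g (q div n) (q mod n) p))"
    by (intro fits_n less_imp_le point_val_less assms)
  show ?thesis
  proof (cases p)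
    case (Guess j)
    \<comment> \<open>The quotient is an intermediate word, bounded by \<open>g\<close> and hence by
      \<open>n ^ M\<close>.\<close>
    have "g div n ^ j \<le> (n + 2) ^ M"
      using assms(1) power_le[OF order_refl] div_le_dividend[of g "n ^ j"]
      unfolding env_def by (meson order_trans)
    from fits_nat[OF this] fit Guess assms show ?thesis
      by (simp add: env_def eval_power word_def of_nat_div of_nat_mod)
  qed (use fit assms in \<open>simp_all add: env_def word_def of_nat_div of_nat_mod\<close>)
qed

lemma eval_adj:
  assumes "env g s" "regs s (N + 3) = int q" "q < n * n" "point_bound p \<le> M" "point_bound p' \<le> M"
  shows "eval w s (Load N (Op Add (Op Mul (point_expr N p) (Reg N)) (point_expr N p'))) =
    Some (of_bool (adj (point_val n g (q div n) (q mod n) p) (point_val n g (q div n) (q mod n) p')))"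
proof -
  define x y where "x = point_val n g (q div n) (q mod n) p" and "y = point_val n g (q div n) (q mod n) p'"
  have xy: "x < n" "y < n"
    unfolding x_def y_def by (intro point_val_less assms)+
  have "x * n + y < n * n"
    using xy by (rule cell_less_square)
  moreover from this have "fits w (int (x * n + y))" "fits w (int (x * n))"
    by (intro fits_square; linarith)+
  moreover have "(x * n + y) div n = x" "(x * n + y) mod n = y"
    using xy by auto
  moreover have "eval w s (point_expr N p) = Some (int x)" "eval w s (point_expr N p') = Some (int y)"
    unfolding x_def y_def using assms by (intro eval_point; simp)+
  ultimately show ?thesis
    using assms(1) unfolding x_def[symmetric] y_def[symmetric]
    by (simp add: word_def env_def nat_add_distrib nat_mult_distrib)
qed

lemma eval_atom:
  assumes "env g s" "regs s (N + 3) = int q" "q < n * n" "atom_bound a \<le> M"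
  shows "eval w s (atom_expr N a) = Some (of_bool (atom_val n adj g (q div n) (q mod n) a))"
proof (cases a)
  case (Edge p p')
  with assms eval_adj[of g s q p p'] show ?thesis by simp
next
  case (Nonedge p p')
  with assms eval_adj[of g s q p p'] show ?thesis by (simp add: word_def)
qed (use assms in \<open>simp_all add: eval_point word_def\<close>)

lemma eval_atoms:
  assumes "env g s" "regs s (N + 3) = int q" "q < n * n" "atoms_bound as \<le> M"
  shows "eval w s (atoms_expr N as) = Some (of_bool (atoms_val n adj g (q div n) (q mod n) as))"
  using assms(4)
proof (induction as)
  case (Cons a as)
  then show ?case
    using eval_atom[OF assms(1-3), of a] by (simp add: word_def flip: of_bool_conj)
qed (simp add: word_def)

section \<open>Correctness and running time of the programs\<close>

lemma run_matrix_loop: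
  assumes n: "regs s N = int n"
    and val: "\<And>q s'. q < n * n \<Longrightarrow> regs s' (N + 3) = int q \<Longrightarrow> \<forall>x. x \<noteq> N + 3 \<longrightarrow> regs s' x = regs s x \<Longrightarrow>
      \<forall>b. b \<noteq> a \<longrightarrow> arrs s' b = arrs s b \<Longrightarrow> eval w s' e = Some (v q)"
  shows "run w (matrix_loop N a e) s ((cost e + 20) * (n * n + 1))
    (\<lambda>s'. (\<forall>x. x \<noteq> N + 3 \<longrightarrow> regs s' x = regs s x) \<and> (\<forall>b. b \<noteq> a \<longrightarrow> arrs s' b = arrs s b) \<and>
      (\<forall>q<n * n. arrs s' a q = v q))"
proof -
  have "run w (loop (N + 3) (power_expr N 2) (Store a (Reg (N + 3)) e)) s
      ((cost e + cost (power_expr N 2) + 12) * (n * n + 1))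
    (\<lambda>s'. (\<forall>x. x \<noteq> N + 3 \<longrightarrow> regs s' x = regs s x) \<and> (\<forall>b. b \<noteq> a \<longrightarrow> arrs s' b = arrs s b) \<and>
      (\<forall>q<n * n. arrs s' a q = v q))"
  proof (rule run_loop_Store)
    show "eval w s' (power_expr N 2) = Some (int (n * n))" if "\<forall>x. x \<noteq> N + 3 \<longrightarrow> regs s' x = regs s x" for s' :: state
      using that n eval_power[of s' 2] M by (simp add: power2_eq_square)
    show "fits w (int (n * n))"
      by (rule fits_square) simp
  qed (use val in auto)
  then show ?thesis
    unfolding matrix_loop_def
    by (rule run_conseq) (auto simp: numeral_2_eq_2 algebra_simps)
qed

text \<open>In the integer product of two 0-1 matrices an entry counts the witnesses
  \<open>z\<close>, so it is positive exactly when the Boolean product is true. The untouched memory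
  comes from \<open>write_bound\<close>.\<close>

lemma run_multiply:
  assumes s: "regs s 0 = int n" "\<forall>q<n * n. arrs s 0 q = of_bool (A (q div n) (q mod n))"
    "\<forall>q<n * n. arrs s 1 q = of_bool (B (q div n) (q mod n))"
  shows "run w mm s Tm (\<lambda>s'. (\<forall>r\<ge>N. regs s' r = regs s r \<and> arrs s' r = arrs s r) \<and>
    (\<forall>q<n * n. 0 < arrs s' 2 q \<longleftrightarrow> (\<exists>z<n. A (q div n) z \<and> B z (q mod n))))"
  unfolding run_def
proof
  assume ws: "word_state w s"
  define A' B' where "A' = mat n n (\<lambda>(i, j). of_bool (A i j) :: int)"
    and "B' = mat n n (\<lambda>(i, j). of_bool (B i j) :: int)"
  have "mm_input 0 n (A', B') s"
    using s cell_less_square by (auto simp: mm_input_def small_matrix_def holds_matrix_def A'_def B'_def)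
  from multiply[OF ws this] obtain t s' where ex: "exec w mm s t s'" "t \<le> Tm" and out: "mm_output n (A', B') s'"
    by blast
  have "0 < arrs s' 2 q \<longleftrightarrow> (\<exists>z<n. A (q div n) z \<and> B z (q mod n))" if q: "q < n * n" for q
  proof -
    note ij = less_square_div_mod[OF q]
    have "\<forall>i<n. \<forall>j<n. arrs s' 2 (i * n + j) = (A' * B') $$ (i, j)"
      using out by (simp add: mm_output_def holds_matrix_def)
    with ij have "arrs s' 2 (q div n * n + q mod n) = (A' * B') $$ (q div n, q mod n)"
      by blast
    also have "\<dots> = (\<Sum>z<n. A' $$ (q div n, z) * B' $$ (z, q mod n))"
      using ij by (simp add: A'_def B'_def scalar_prod_def atLeast0LessThan)
    also have "\<dots> = (\<Sum>z<n. of_bool (A (q div n) z \<and> B z (q mod n)))"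
      using ij by (intro sum.cong) (auto simp: A'_def B'_def)
    finally have "arrs s' 2 q = (\<Sum>z<n. of_bool (A (q div n) z \<and> B z (q mod n)))"
      by simp
    moreover have "0 < (\<Sum>z<n. of_bool (A (q div n) z \<and> B z (q mod n)) :: int) \<longleftrightarrow>
        (\<exists>z<n. A (q div n) z \<and> B z (q mod n))"
      by (subst sum_nonneg_eq_0_iff[THEN arg_cong[where f = Not], simplified, symmetric] order_less_le)
        (auto simp: sum_nonneg)
    ultimately show ?thesis
      by simp
  qed
  moreover have "\<forall>r\<ge>N. regs s' r = regs s r \<and> arrs s' r = arrs s r"
    using exec_frame[OF ex(1)] N(2) by (meson order_trans)
  ultimately show "\<exists>t s'. exec w mm s t s' \<and> t \<le> Tm \<and> word_state w s' \<and>
      (\<forall>r\<ge>N. regs s' r = regs s r \<and> arrs s' r = arrs s r) \<and>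
      (\<forall>q<n * n. 0 < arrs s' 2 q \<longleftrightarrow> (\<exists>z<n. A (q div n) z \<and> B z (q mod n)))"
    using ex exec_word_state[OF ex(1) ws] by blast
qed

text \<open>The target array is arbitrary in the induction because the right subtree is compiled for
  \<open>Suc b\<close>; there \<open>keeps\<close> also protects array \<open>b\<close>, which holds
  the left factor.\<close>

lemma run_compile:
  assumes "env g s" "plan_bound t \<le> M" "N < b"
  shows "run w (compile mm N b t) s (plan_cost N t * (n * n + 1 + Tm)) (\<lambda>s'. keeps b s s' \<and>
    (\<forall>q<n * n. arrs s' b q = of_bool (plan_val n adj g t (q div n) (q mod n))))"
  using assms
proof (induction t arbitrary: s b)
  case (Base as)
  have "run w (matrix_loop N b (atoms_expr N as)) s ((cost (atoms_expr N as) + 20) * (n * n + 1))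
    (\<lambda>s'. (\<forall>x. x \<noteq> N + 3 \<longrightarrow> regs s' x = regs s x) \<and> (\<forall>a. a \<noteq> b \<longrightarrow> arrs s' a = arrs s a) \<and>
      (\<forall>q<n * n. arrs s' b q = of_bool (atoms_val n adj g (q div n) (q mod n) as)))"
  proof (rule run_matrix_loop)
    fix q and s' :: state assume q: "q < n * n" "regs s' (N + 3) = int q"
      and same: "\<forall>x. x \<noteq> N + 3 \<longrightarrow> regs s' x = regs s x" "\<forall>a. a \<noteq> b \<longrightarrow> arrs s' a = arrs s a"
    have "env g s'"
      using Base same by (auto simp: env_def)
    then show "eval w s' (atoms_expr N as) = Some (of_bool (atoms_val n adj g (q div n) (q mod n) as))"
      using q Base by (intro eval_atoms) auto
  qed (use Base in \<open>simp add: env_def\<close>)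
  then show ?case
    unfolding compile.simps by (rule run_conseq) (use Base in \<open>auto simp: keeps_def\<close>)
next
  case (Join as l r)
  define L where "L = plan_val n adj g l"
  define R where "R = plan_val n adj g r"
  define holds where "holds a A s' \<longleftrightarrow> (\<forall>q<n * n. arrs s' a q = of_bool (A (q div n) (q mod n)))"
    for a A and s' :: state
  define Z where "Z = n * n + 1"
  define Y where "Y = Z + Tm"
  define last_expr where "last_expr = Op Mul (Op Less (Const 0) (Load 2 (Reg (N + 3)))) (atoms_expr N as)"
  define post where "post s' \<longleftrightarrow> keeps b s s' \<and> holds b (plan_val n adj g (Join as l r)) s'" for s' :: state
  have env: "env g s'" if "keeps b s s'" for s' :: state
    using env_keeps[OF Join.prems(1) that Join.prems(3)] .
  have env_n: "regs s' N = int n" if "env g s'" for s' :: state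
    using that by (simp add: env_def)

  \<comment> \<open>Assertions between the seven commands of a \<open>Join\<close>. After
    \<open>mm\<close> only array 2 and the protected memory are recorded, since anything below
    \<open>N\<close> may have changed.\<close>
  define S1 where "S1 s' \<longleftrightarrow> keeps b s s' \<and> holds b L s'" for s' :: state
  define S2 where "S2 s' \<longleftrightarrow> S1 s' \<and> holds (Suc b) R s'" for s' :: state
  define S3 where "S3 s' \<longleftrightarrow> S2 s' \<and> holds 0 L s'" for s' :: state
  define S4 where "S4 s' \<longleftrightarrow> S3 s' \<and> holds 1 R s'" for s' :: state
  define S5 where "S5 s' \<longleftrightarrow> S4 s' \<and> regs s' 0 = int n" for s' :: state
  define S6 where "S6 s' \<longleftrightarrow> keeps b s s' \<and>
    (\<forall>q<n * n. 0 < arrs s' 2 q \<longleftrightarrow> (\<exists>z<n. L (q div n) z \<and> R z (q mod n)))" for s' :: state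

  have 1: "run w (compile mm N b l) s (plan_cost N l * Y) S1"
    using Join.IH(1)[OF Join.prems(1) _ Join.prems(3)] Join.prems(2)
    by (simp add: S1_def[abs_def] holds_def L_def Y_def Z_def)
  have 2: "run w (compile mm N (Suc b) r) s' (plan_cost N r * Y) S2" if "S1 s'" for s' :: state
  proof (rule run_conseq[OF Join.IH(2)])
    show "env g s'"
      using that by (simp add: S1_def env)
    fix s'' :: state assume *: "keeps (Suc b) s' s'' \<and>
      (\<forall>q<n * n. arrs s'' (Suc b) q = of_bool (plan_val n adj g r (q div n) (q mod n)))"
    then have "arrs s'' b = arrs s' b"
      using Join.prems(3) by (simp add: keeps_def)
    with * that show "S2 s''"
      using keeps_trans[of b s s' "Suc b" s''] by (simp add: S2_def S1_def holds_def R_def)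
  qed (use Join.prems in \<open>simp_all add: Y_def Z_def\<close>)
  have copy: "run w (matrix_loop N c (Load a (Reg (N + 3)))) s' (22 * Z)
      (\<lambda>s''. keeps b s' s'' \<and> (\<forall>a. a \<noteq> c \<longrightarrow> arrs s'' a = arrs s' a) \<and> holds c A s'')"
    if "c < N" "N \<le> a" "keeps b s s'" "holds a A s'" for c a A and s' :: state
  proof -
    have "run w (matrix_loop N c (Load a (Reg (N + 3)))) s' ((cost (Load a (Reg (N + 3))) + 20) * (n * n + 1))
      (\<lambda>s''. (\<forall>x. x \<noteq> N + 3 \<longrightarrow> regs s'' x = regs s' x) \<and> (\<forall>a. a \<noteq> c \<longrightarrow> arrs s'' a = arrs s' a) \<and>
        (\<forall>q<n * n. arrs s'' c q = of_bool (A (q div n) (q mod n))))"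
      by (rule run_matrix_loop) (use that env_n[OF env] in \<open>auto simp: holds_def\<close>)
    then show ?thesis
      by (rule run_conseq) (use that in \<open>auto simp: keeps_def holds_def Z_def\<close>)
  qed
  have 3: "run w (matrix_loop N 0 (Load b (Reg (N + 3)))) s' (22 * Z) S3" if "S2 s'" for s' :: state
    by (rule run_conseq[OF copy[of 0 b s' L]])
      (use that N Join.prems(3) in \<open>auto simp: S3_def S2_def S1_def holds_def intro: keeps_trans\<close>)
  have 4: "run w (matrix_loop N 1 (Load (Suc b) (Reg (N + 3)))) s' (22 * Z) S4" if "S3 s'" for s' :: state
    by (rule run_conseq[OF copy[of 1 "Suc b" s' R]])
      (use that N Join.prems(3) in \<open>auto simp: S4_def S3_def S2_def S1_def holds_def intro: keeps_trans\<close>)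
  have 5: "run w (Assign 0 (Reg N)) s' 2 S5" if "S4 s'" for s' :: state
    by (rule run_Assign[where v = "int n"])
      (use that N env_n[OF env] in \<open>auto simp: S5_def S4_def S3_def S2_def S1_def holds_def keeps_def\<close>)
  have 6: "run w mm s' Tm S6" if "S5 s'" for s' :: state
    by (rule run_conseq[OF run_multiply[of s' L R]])
      (use that in \<open>auto simp: S6_def S5_def S4_def S3_def S2_def S1_def holds_def keeps_def\<close>)
  have 7: "run w (matrix_loop N b last_expr) s' ((cost (atoms_expr N as) + 25) * Z) post" if "S6 s'" for s' :: state
  proof -
    have "run w (matrix_loop N b last_expr) s' ((cost last_expr + 20) * (n * n + 1))
      (\<lambda>s''. (\<forall>x. x \<noteq> N + 3 \<longrightarrow> regs s'' x = regs s' x) \<and> (\<forall>a. a \<noteq> b \<longrightarrow> arrs s'' a = arrs s' a) \<and>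
        (\<forall>q<n * n. arrs s'' b q = of_bool (plan_val n adj g (Join as l r) (q div n) (q mod n))))"
    proof (rule run_matrix_loop)
      show "regs s' N = int n"
        using that env_n env by (simp add: S6_def)
      fix q and s'' :: state assume q: "q < n * n" "regs s'' (N + 3) = int q"
        and same: "\<forall>x. x \<noteq> N + 3 \<longrightarrow> regs s'' x = regs s' x" "\<forall>a. a \<noteq> b \<longrightarrow> arrs s'' a = arrs s' a"
      have "env g s''"
        using env[of s'] that same Join.prems(3) by (auto simp: env_def S6_def)
      then have "eval w s'' (atoms_expr N as) = Some (of_bool (atoms_val n adj g (q div n) (q mod n) as))"
        using q Join.prems by (intro eval_atoms) auto
      \<comment> \<open>The loop writes array \<open>b\<close>, and \<open>b > N \<ge> 3\<close>, so
        the product that it reads stays intact.\<close>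
      moreover have "arrs s'' 2 = arrs s' 2"
        using same(2) N Join.prems(3) by simp
      ultimately show "eval w s'' last_expr =
          Some (of_bool (plan_val n adj g (Join as l r) (q div n) (q mod n)))"
        using q that by (auto simp: last_expr_def word_def S6_def L_def R_def)
    qed
    then show ?thesis
      by (rule run_conseq) (use that in \<open>auto simp: S6_def post_def keeps_def holds_def last_expr_def Z_def\<close>)
  qed
  note seq = run_Seq'[OF _ _ order_refl]
  have "run w (compile mm N b (Join as l r)) s (plan_cost N l * Y + (plan_cost N r * Y +
      (22 * Z + (22 * Z + (2 + (Tm + (cost (atoms_expr N as) + 25) * Z)))))) post"
    unfolding compile.simps last_expr_def[symmetric]
    by (rule seq[OF 1 seq[OF 2 seq[OF 3 seq[OF 4 seq[OF 5 seq[OF 6 7]]]]]])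
  moreover have "plan_cost N l * Y + (plan_cost N r * Y +
      (22 * Z + (22 * Z + (2 + (Tm + (cost (atoms_expr N as) + 25) * Z))))) \<le>
      plan_cost N (Join as l r) * Y"
  proof -
    have "(cost (atoms_expr N as) + 25) * Z \<le> (cost (atoms_expr N as) + 25) * Y" "Z \<le> Y" "Tm \<le> Y" "1 \<le> Y"
      by (simp_all add: Y_def Z_def)
    then show ?thesis
      by (simp add: algebra_simps)
  qed
  ultimately show ?case
    unfolding post_def holds_def Y_def Z_def by (rule run_conseq)
qed

lemma ex_cell: "(\<exists>q<n * n. Q (q div n) (q mod n)) \<longleftrightarrow> (\<exists>x<n. \<exists>y<n. Q x y)"
proof
  assume "\<exists>x<n. \<exists>y<n. Q x y"
  then obtain x y where xy: "x < n" "y < n" "Q x y" by blast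
  then show "\<exists>q<n * n. Q (q div n) (q mod n)"
    using cell_less_square[of x n y] by (intro exI[of _ "x * n + y"]) auto
qed (use less_square_div_mod in blast)

text \<open>By the invariant \<open>S3\<close> of the outer loop, register \<open>N + 2\<close>
  tells whether some earlier guess succeeded. Each guess costs one compiled plan and one scan over
  its \<open>n * n\<close> cells.\<close>

lemma run_detect:
  assumes s: "regs s 0 = int n" "\<And>x. x < n \<Longrightarrow> arrs s 1 x = int (ord x)" "\<And>x. x < n \<Longrightarrow> ord x < n"
    "\<And>x y. x < n \<Longrightarrow> y < n \<Longrightarrow> arrs s 0 (ord x * n + ord y) = of_bool (adj x y)"
    and bounds: "m \<le> M" "plan_bound t \<le> M" "atoms_bound sc \<le> M"
  shows "run w (detect mm N m t sc) s
    ((plan_cost N t + cost (atoms_expr N sc) + 2 * m + 100) * (n * n + 1 + Tm) * (n ^ m + 1))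
    (\<lambda>s'. regs s' 0 = of_bool (\<exists>g<n ^ m. \<exists>x<n. \<exists>y<n.
      plan_val n adj g t x y \<and> atoms_val n adj g x y sc))"
proof -
  define Z where "Z = n * n + 1"
  define Y where "Y = Z + Tm"
  define found where "found g \<longleftrightarrow> (\<exists>x<n. \<exists>y<n. plan_val n adj g t x y \<and> atoms_val n adj g x y sc)" for g
  define adj_expr where "adj_expr = Load 0 (Op Add (Op Mul (Load 1 (point_expr N First)) (Reg N))
    (Load 1 (point_expr N Second)))"
  define S1 where "S1 s' \<longleftrightarrow> regs s' N = int n \<and> arrs s' = arrs s" for s' :: state
  define S2 where "S2 s' \<longleftrightarrow> regs s' N = int n \<and>
    (\<forall>q<n * n. arrs s' N q = of_bool (adj (q div n) (q mod n)))" for s' :: state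
  define S3 where "S3 i s' \<longleftrightarrow> S2 s' \<and> regs s' (N + 2) = of_bool (\<exists>g<i. found g)" for i and s' :: state
  have 1: "run w (Assign N (Reg 0)) s 2 S1"
    by (rule run_Assign[where v = "int n"]) (use s N in \<open>auto simp: S1_def\<close>)
  have 2: "run w (matrix_loop N N adj_expr) s' (32 * Z) S2" if "S1 s'" for s' :: state
  proof -
    have "run w (matrix_loop N N adj_expr) s' ((cost adj_expr + 20) * (n * n + 1))
      (\<lambda>s''. (\<forall>x. x \<noteq> N + 3 \<longrightarrow> regs s'' x = regs s' x) \<and> (\<forall>a. a \<noteq> N \<longrightarrow> arrs s'' a = arrs s' a) \<and>
        (\<forall>q<n * n. arrs s'' N q = of_bool (adj (q div n) (q mod n))))"
    proof (rule run_matrix_loop)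
      show "regs s' N = int n"
        using that by (simp add: S1_def)
      fix q and s'' :: state assume q: "q < n * n" "regs s'' (N + 3) = int q"
        and same: "\<forall>x. x \<noteq> N + 3 \<longrightarrow> regs s'' x = regs s' x" "\<forall>a. a \<noteq> N \<longrightarrow> arrs s'' a = arrs s' a"
      define x y where "x = q div n" and "y = q mod n"
      have xy: "x < n" "y < n"
        using less_square_div_mod[OF q(1)] by (simp_all add: x_def y_def)
      have ord: "ord x < n" "ord y < n"
        using s(3) xy by auto
      have arrs: "arrs s'' 0 = arrs s 0" "arrs s'' 1 = arrs s 1" and reg: "regs s'' N = int n"
        using same that N by (auto simp: S1_def)
      have "eval w s'' (point_expr N First) = Some (int x)" "eval w s'' (point_expr N Second) = Some (int y)"
        using q reg xy fits_n by (simp_all add: word_def x_def y_def less_imp_le flip: zdiv_int zmod_int)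
      moreover have "ord x * n + ord y < n * n"
        using ord by (rule cell_less_square)
      moreover from this have "fits w (int (ord x * n + ord y))" "fits w (int (ord x * n))"
        by (intro fits_square; linarith)+
      ultimately show "eval w s'' adj_expr = Some (of_bool (adj (q div n) (q mod n)))"
        using s xy arrs reg
        by (simp add: adj_expr_def word_def nat_add_distrib nat_mult_distrib flip: x_def y_def del: point_expr.simps)
    qed
    then show ?thesis
      by (rule run_conseq) (use that in \<open>auto simp: S1_def S2_def adj_expr_def Z_def\<close>)
  qed
  \<comment> \<open>The postcondition speaks of the state with the counter already reset, because
    \<open>run_loop\<close> demands its invariant there.\<close>
  have 3: "run w (Assign (N + 2) (Const 0)) s' 2
      (\<lambda>s'. \<forall>s''. s'' = s'\<lparr>regs := (regs s')(N + 1 := 0)\<rparr> \<longrightarrow> S3 0 s'')" if "S2 s'" for s' :: state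
    by (rule run_Assign[where v = 0]) (use that in \<open>auto simp: S3_def S2_def word_def\<close>)
  let ?scan = "loop (N + 3) (power_expr N 2) (Assign (N + 2) (Op Or (Reg (N + 2))
    (Op Mul (Load (N + 1) (Reg (N + 3))) (atoms_expr N sc))))"
  have scan: "run w ?scan s' ((cost (atoms_expr N sc) + 21) * Z)
      (\<lambda>s''. regs s'' (N + 1) = int g \<and> S2 s'' \<and> regs s'' (N + 2) = of_bool (b \<or> found g))"
    if s': "env g s'" "regs s' (N + 2) = of_bool b"
      "\<forall>q<n * n. arrs s' (N + 1) q = of_bool (plan_val n adj g t (q div n) (q mod n))" for g b and s' :: state
  proof -
    define hit where "hit q \<longleftrightarrow> plan_val n adj g t (q div n) (q mod n) \<and>
      atoms_val n adj g (q div n) (q mod n) sc" for q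
    define Inv where "Inv i s'' \<longleftrightarrow> env g s'' \<and> arrs s'' = arrs s' \<and>
      regs s'' (N + 2) = of_bool (b \<or> (\<exists>q<i. hit q))" for i and s'' :: state
    have "run w ?scan s' ((cost (atoms_expr N sc) + 6 + cost (power_expr N 2) + 10) * (n * n + 1)) (Inv (n * n))"
    proof (rule run_loop)
      fix i and s'' :: state assume i: "i < n * n" "Inv i s''" "regs s'' (N + 3) = int i"
      have "eval w s'' (atoms_expr N sc) = Some (of_bool (atoms_val n adj g (i div n) (i mod n) sc))"
        using i bounds by (intro eval_atoms) (auto simp: Inv_def)
      \<comment> \<open>On the words 0 and 1, product and bitwise \<open>Or\<close> act as
        conjunction and disjunction.\<close>
      then have "eval w s'' (Op Or (Reg (N + 2)) (Op Mul (Load (N + 1) (Reg (N + 3))) (atoms_expr N sc))) =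
          Some (of_bool (b \<or> (\<exists>q<Suc i. hit q)))"
        using i s'(3) by (auto simp: word_def Inv_def hit_def less_Suc_eq)
      then show "run w (Assign (N + 2) (Op Or (Reg (N + 2)) (Op Mul (Load (N + 1) (Reg (N + 3))) (atoms_expr N sc))))
          s'' (cost (atoms_expr N sc) + 6) (\<lambda>s'. regs s' (N + 3) = int i \<and>
            Inv (Suc i) (s'\<lparr>regs := (regs s')(N + 3 := int i + 1)\<rparr>))"
        by (rule run_Assign) (use i in \<open>auto simp: Inv_def env_def\<close>)
    next
      show "eval w s'' (power_expr N 2) = Some (int (n * n))" if "Inv i s''" for i and s'' :: state
        using that eval_power[of s'' 2] M by (simp add: Inv_def env_def power2_eq_square)
      show "fits w (int (n * n))"
        by (rule fits_square) simp
      show "Inv 0 (s'\<lparr>regs := (regs s')(N + 3 := 0)\<rparr>)"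
        using s' by (simp add: Inv_def env_def)
    qed simp
    moreover have "found g \<longleftrightarrow> (\<exists>q<n * n. hit q)"
      unfolding found_def hit_def by (rule ex_cell[symmetric])
    ultimately show ?thesis
      by (elim run_conseq) (auto simp: Inv_def env_def S2_def Z_def numeral_2_eq_2 algebra_simps)
  qed
  let ?body = "Seq (compile mm N (N + 1) t) ?scan"
  have 4: "run w (loop (N + 1) (power_expr N m) ?body) s'
      ((plan_cost N t * Y + (cost (atoms_expr N sc) + 21) * Z + cost (power_expr N m) + 10) * (n ^ m + 1))
      (S3 (n ^ m))"
    if s': "\<forall>s''. s'' = s'\<lparr>regs := (regs s')(N + 1 := 0)\<rparr> \<longrightarrow> S3 0 s''" for s' :: state
  proof (rule run_loop)
    fix i and s'' :: state assume i: "i < n ^ m" "S3 i s''" "regs s'' (N + 1) = int i"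
    \<comment> \<open>For \<open>n = 0\<close> powers are not monotone in the exponent, as
      \<open>0 ^ 0 = 1\<close>; but then \<open>i < n ^ m\<close> forces
      \<open>i = 0\<close>.\<close>
    have "i \<le> n ^ M"
    proof (cases "n = 0")
      case False
      then have "n ^ m \<le> n ^ M"
        using bounds(1) by (intro power_increasing) auto
      with i(1) show ?thesis by simp
    qed (use i(1) in \<open>auto simp: power_0_left split: if_splits\<close>)
    then have env: "env i s''"
      using i by (simp add: env_def S3_def S2_def)
    show "run w ?body s'' (plan_cost N t * Y + (cost (atoms_expr N sc) + 21) * Z)
      (\<lambda>s'. regs s' (N + 1) = int i \<and> S3 (Suc i) (s'\<lparr>regs := (regs s')(N + 1 := int i + 1)\<rparr>))"
    proof (rule run_Seq'[OF _ _ order_refl])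
      show "run w (compile mm N (N + 1) t) s'' (plan_cost N t * Y) (\<lambda>s'. keeps (N + 1) s'' s' \<and>
          (\<forall>q<n * n. arrs s' (N + 1) q = of_bool (plan_val n adj i t (q div n) (q mod n))))"
        unfolding Y_def Z_def by (rule run_compile) (use env bounds in auto)
      fix s' :: state assume *: "keeps (N + 1) s'' s' \<and>
          (\<forall>q<n * n. arrs s' (N + 1) q = of_bool (plan_val n adj i t (q div n) (q mod n)))"
      have "env i s'"
        using env_keeps[OF env, of "N + 1" s'] * by simp
      moreover have "regs s' (N + 2) = of_bool (\<exists>g<i. found g)"
        using * i(2) by (simp add: keeps_def S3_def)
      ultimately show "run w ?scan s' ((cost (atoms_expr N sc) + 21) * Z)
          (\<lambda>s'. regs s' (N + 1) = int i \<and> S3 (Suc i) (s'\<lparr>regs := (regs s')(N + 1 := int i + 1)\<rparr>))"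
        using * by (intro run_conseq[OF scan]) (auto simp: S3_def S2_def less_Suc_eq)
    qed
  next
    show "eval w s'' (power_expr N m) = Some (int (n ^ m))" if "S3 i s''" for i and s'' :: state
      using that eval_power bounds by (simp add: S3_def S2_def)
    show "fits w (int (n ^ m))"
      by (intro fits_nat power_le bounds)
  qed (use s' in auto)
  have 5: "run w (Assign 0 (Reg (N + 2))) s' 2 (\<lambda>s'. regs s' 0 = of_bool (\<exists>g<n ^ m. found g))"
    if "S3 (n ^ m) s'" for s' :: state
    by (rule run_Assign[where v = "of_bool (\<exists>g<n ^ m. found g)"]) (use that in \<open>auto simp: S3_def\<close>)
  note seq = run_Seq'[OF _ _ order_refl]
  have "run w (detect mm N m t sc) s (2 + (32 * Z + (2 + ((plan_cost N t * Y +
      (cost (atoms_expr N sc) + 21) * Z + cost (power_expr N m) + 10) * (n ^ m + 1) + 2))))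
      (\<lambda>s'. regs s' 0 = of_bool (\<exists>g<n ^ m. found g))"
    unfolding detect_def adj_expr_def[symmetric]
    by (rule seq[OF 1 seq[OF 2 seq[OF 3 seq[OF 4 5]]]])
  moreover have "2 + (32 * Z + (2 + ((plan_cost N t * Y +
      (cost (atoms_expr N sc) + 21) * Z + cost (power_expr N m) + 10) * (n ^ m + 1) + 2))) \<le>
      (plan_cost N t + cost (atoms_expr N sc) + 2 * m + 100) * Y * (n ^ m + 1)"
  proof -
    define X where "X = n ^ m + 1"
    have c: "cost (power_expr N m) = 2 * m + 1" for m
      by (induction m) auto
    have ZY: "Z \<le> Y" "1 \<le> Y" "1 \<le> X"
      by (simp_all add: Y_def Z_def X_def)
    have "(cost (atoms_expr N sc) + 21) * Z \<le> (cost (atoms_expr N sc) + 21) * Y"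
      "2 * m + 11 \<le> (2 * m + 11) * Y"
      using ZY by simp_all
    then have "plan_cost N t * Y + (cost (atoms_expr N sc) + 21) * Z + cost (power_expr N m) + 10 \<le>
        (plan_cost N t + cost (atoms_expr N sc) + 2 * m + 32) * Y"
      by (simp add: c algebra_simps)
    then have "(plan_cost N t * Y + (cost (atoms_expr N sc) + 21) * Z + cost (power_expr N m) + 10) * X \<le>
        (plan_cost N t + cost (atoms_expr N sc) + 2 * m + 32) * Y * X"
      by (rule mult_le_mono1)
    moreover have "2 + (32 * Z + (2 + 2)) \<le> 38 * (Y * X)"
      using mult_le_mono[OF ZY(1,3)] mult_le_mono[OF ZY(2,3)] unfolding mult_1_right by linarith
    ultimately show ?thesis
      unfolding X_def[symmetric] by (simp add: algebra_simps)
  qed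
  ultimately show ?thesis
    unfolding found_def Y_def Z_def by (rule run_conseq)
qed

end

section \<open>Running time\<close>

lemma power_bigo_powr:
  assumes "real j \<le> e"
  shows "(\<lambda>n. real (n ^ j + 1)) \<in> O(\<lambda>n. real n powr e)"
proof (rule bigoI[of _ 2], rule eventually_mono[OF eventually_ge_at_top[of 1]])
  fix n :: nat
  assume n: "1 \<le> n"
  then have "real n ^ j = real n powr real j"
    by (simp add: powr_realpow)
  also have "\<dots> \<le> real n powr e"
    using n assms by (intro powr_mono) auto
  finally have "real n ^ j \<le> real n powr e" .
  moreover have "1 \<le> real n powr e"
    using n assms by (intro ge_one_powr_ge_zero) auto
  ultimately show "norm (real (n ^ j + 1)) \<le> 2 * norm (real n powr e)"
    by simp
qed

text \<open>At most one vertex means no pair to constrain, so only the number of graph vertices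
  matters. The case stands apart because a plan spans an interval with two distinct ends.\<close>

lemma contains_small_pattern:
  fixes P :: "'a::linorder pattern"
  assumes "is_pattern P" "is_ordered_graph G" "gverts G = {..<n}" "card (pverts P) < 2"
  shows "contains_pattern G P \<longleftrightarrow> card (pverts P) \<le> n"
proof -
  have "card (pverts P) = 0 \<or> card (pverts P) = 1"
    using assms(4) by linarith
  then show ?thesis
    unfolding contains_pattern_iff_embeds[OF assms(1-3)] embeds_def by (auto intro: exI[of _ "\<lambda>_. 0"])
qed

theorem theorem8:
  fixes \<omega> :: real and P :: "'a::linorder pattern"
  assumes "matrix_multiplication_in_time (\<lambda>n. real n powr \<omega>)"
    and "is_pattern P"
  shows "\<exists>c. detects_in_time c P (\<lambda>n. real n powr (\<omega> * real (dist_out P + 1)))"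
proof -
  define d where "d = dist_out P"
  define k where "k = card (pverts P)"
  have \<omega>: "2 \<le> \<omega>"
    using assms(1) by (rule matrix_multiplication_exponent)
  show ?thesis
  proof (cases "k < 2")
    case True
    \<comment> \<open>\<open>k \<le> n\<close> is tested as \<open>k - 1 < n\<close>; for
      \<open>k < 2\<close> the constant fits into words of length 1.\<close>
    define c where "c = Assign 0 (Op Less (Const (int k - 1)) (Reg 0))"
    have "detects_in_time c P (\<lambda>n. real n powr (\<omega> * real (d + 1)))"
      unfolding detects_in_time_def solves_in_time_def
    proof (rule exI[of _ "\<lambda>_. 4"], rule exI[of _ "\<lambda>_. 1"], intro conjI allI impI)
      have "(\<lambda>n. 2 * real (n ^ 0 + 1)) \<in> O(\<lambda>n. real n powr (\<omega> * real (d + 1)))"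
        using power_bigo_powr[of 0 "\<omega> * real (d + 1)"] \<omega> by simp
      then show "(\<lambda>n. real 4) \<in> O(\<lambda>n. real n powr (\<omega> * real (d + 1)))"
        by simp
      show "(\<lambda>n. real 1) \<in> O(\<lambda>n. ln (real n))"
        by real_asymp
    next
      fix n G w s
      assume "1 \<le> (w::nat)" "word_state w s" and G: "detection_input n G s"
      have "(2::int) ^ 1 \<le> 2 ^ w"
        using \<open>1 \<le> w\<close> by (intro power_increasing) auto
      then have "fits w (int k - 1)" "fits w 1"
        using True by (auto simp: fits_def)
      then have "eval w s (Op Less (Const (int k - 1)) (Reg 0)) = Some (of_bool (k \<le> n))"
        using G by (auto simp: word_def detection_input_def)
      from exec.Assign[OF this, of 0]
      show "\<exists>t s'. exec w c s t s' \<and> t \<le> 4 \<and> detection_output P n G s'"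
        using G contains_small_pattern[OF assms(2), of G n] True
        by (intro exI conjI) (auto simp: c_def detection_output_def detection_input_def k_def)
    qed
    then show ?thesis
      unfolding d_def by blast
  next
    case False
    then obtain sc t where plan: "\<And>n G. is_ordered_graph G \<Longrightarrow> gverts G = {..<n} \<Longrightarrow>
      contains_pattern G P \<longleftrightarrow> (\<exists>g<n ^ (2 * d). \<exists>x<n. \<exists>y<n.
        plan_val n (\<lambda>x y. {gorder G ! x, gorder G ! y} \<in> gedges G) g t x y \<and>
        atoms_val n (\<lambda>x y. {gorder G ! x, gorder G ! y} \<in> gedges G) g x y sc)"
      using plan_for_pattern[OF assms(2)] unfolding k_def d_def not_less by metis
    \<comment> \<open>The exponent for the size of entries is instantiated with 0, as only 0-1
      matrices are multiplied.\<close>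
    obtain mm T b where T: "(\<lambda>n. real (T n)) \<in> O(\<lambda>n. real n powr \<omega>)"
      and b: "(\<lambda>n. real (b n)) \<in> O(\<lambda>n. ln (real n))"
      and mm: "\<And>n x w s. b n \<le> w \<Longrightarrow> word_state w s \<Longrightarrow> mm_input 0 n x s \<Longrightarrow>
        \<exists>t s'. exec w mm s t s' \<and> t \<le> T n \<and> mm_output n x s'"
      using assms(1) unfolding matrix_multiplication_in_time_def solves_in_time_def by metis
    define N where "N = max 3 (write_bound mm)"
    \<comment> \<open>The exponent 2 serves the counter of matrix cells, \<open>2 * d\<close> the
      guesses, and the rest the digits that \<open>t\<close> and \<open>sc\<close> extract.\<close>
    define M where "M = max (max 2 (2 * d)) (max (plan_bound t) (atoms_bound sc))"
    define D where "D = plan_cost N t + cost (atoms_expr N sc) + 2 * (2 * d) + 100"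
    \<comment> \<open>\<open>2 ^ bits n\<close> is at least \<open>n + 3\<close>, so words of
      \<open>M * bits n\<close> bits leave room for \<open>(n + 2) ^ M\<close>, and this length is
      still logarithmic.\<close>
    define bits where "bits n = nat \<lceil>log 2 (real n + 3)\<rceil>" for n
    have bits: "(n + 2) ^ M < 2 ^ w" if "M * bits n \<le> w" for n w
    proof -
      have "log 2 (real n + 3) \<le> real (bits n)"
        unfolding bits_def by linarith
      then have "real n + 3 \<le> 2 powr real (bits n)"
        by (simp add: log_le_iff)
      then have "real (n + 3) \<le> real (2 ^ bits n)"
        by (simp add: powr_realpow)
      then have "n + 2 < 2 ^ bits n"
        by (simp only: of_nat_le_iff)
      then have "(n + 2) ^ M < (2 ^ bits n) ^ M"
        by (intro power_strict_mono) (auto simp: M_def)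
      also have "\<dots> = 2 ^ (M * bits n)"
        by (simp only: power_mult[symmetric] mult.commute)
      also have "\<dots> \<le> 2 ^ w"
        using that by (intro power_increasing) auto
      finally show ?thesis .
    qed
    have "detects_in_time (detect mm N (2 * d) t sc) P (\<lambda>n. real n powr (\<omega> * real (d + 1)))"
      unfolding detects_in_time_def solves_in_time_def
    proof (rule exI[of _ "\<lambda>n. D * (n * n + 1 + T n) * (n ^ (2 * d) + 1)"],
        rule exI[of _ "\<lambda>n. b n + M * bits n"], intro conjI allI impI)
      \<comment> \<open>\<open>2 \<le> \<omega>\<close> absorbs the quadratic work per guess into
        the cost of multiplication.\<close>
      have "(\<lambda>n. real (n ^ 2 + 1) + real (T n)) \<in> O(\<lambda>n. real n powr \<omega>)"
        using power_bigo_powr[of 2 \<omega>] \<omega> T by (intro sum_in_bigo) auto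
      then have "(\<lambda>n. real D * (real (n ^ 2 + 1) + real (T n))) \<in> O(\<lambda>n. real n powr \<omega>)"
        by (rule landau_o.big.cmult_in_iff[THEN iffD2, rotated]) (simp add: D_def)
      \<comment> \<open>Again by \<open>2 \<le> \<omega>\<close>, the two guessed positions of a
        removed edge are paid for by one factor \<open>n powr \<omega>\<close>.\<close>
      moreover have "(\<lambda>n. real (n ^ (2 * d) + 1)) \<in> O(\<lambda>n. real n powr (\<omega> * real d))"
        using \<omega> by (intro power_bigo_powr) (simp add: mult_right_mono)
      ultimately have "(\<lambda>n. real D * (real (n ^ 2 + 1) + real (T n)) * real (n ^ (2 * d) + 1)) \<in>
          O(\<lambda>n. real n powr \<omega> * real n powr (\<omega> * real d))"
        by (rule landau_o.big.mult)
      then show "(\<lambda>n. real (D * (n * n + 1 + T n) * (n ^ (2 * d) + 1))) \<in>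
          O(\<lambda>n. real n powr (\<omega> * real (d + 1)))"
        by (simp add: power2_eq_square algebra_simps flip: powr_add)
    next
      \<comment> \<open>The added 1 pays for rounding up.\<close>
      have "(\<lambda>n. real (bits n)) \<in> O(\<lambda>n. log 2 (real n + 3) + 1)"
      proof (rule landau_o.big_mono, rule always_eventually, rule allI)
        fix n :: nat
        have "0 \<le> log 2 (real n + 3)"
          by (simp add: zero_le_log_cancel_iff)
        moreover from this have "real (bits n) = of_int \<lceil>log 2 (real n + 3)\<rceil>"
          by (simp add: bits_def)
        ultimately show "norm (real (bits n)) \<le> norm (log 2 (real n + 3) + 1)"
          unfolding real_norm_def by linarith
      qed
      also have "(\<lambda>n. log 2 (real n + 3) + 1) \<in> O(\<lambda>n. ln (real n))"
        by real_asymp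
      finally show "(\<lambda>n. real (b n + M * bits n)) \<in> O(\<lambda>n. ln (real n))"
        using b by (auto intro!: sum_in_bigo)
    next
      fix n G w s
      assume w: "b n + M * bits n \<le> w" "word_state w s" and G: "detection_input n G s"
      define adj where "adj x y \<longleftrightarrow> {gorder G ! x, gorder G ! y} \<in> gedges G" for x y
      interpret detection_machine w n N M "T n" adj mm
      proof
        show "\<exists>t s'. exec w mm s t s' \<and> t \<le> T n \<and> mm_output n x s'"
          if "word_state w s" "mm_input 0 n x s" for x s
          using mm that w(1) by simp
      qed (use bits w(1) in \<open>auto simp: N_def M_def\<close>)
      have G': "is_ordered_graph G" "gverts G = {..<n}"
        using G by (auto simp: detection_input_def)
      then have "length (gorder G) = n"
        by (metis card_lessThan distinct_card is_ordered_graph_def)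
      then have "gorder G ! x < n" if "x < n" for x
        using that G' nth_mem[of x "gorder G"] by (simp add: is_ordered_graph_def)
      then have "run w (detect mm N (2 * d) t sc) s (D * (n * n + 1 + T n) * (n ^ (2 * d) + 1))
          (\<lambda>s'. regs s' 0 = of_bool (\<exists>g<n ^ (2 * d). \<exists>x<n. \<exists>y<n.
            plan_val n adj g t x y \<and> atoms_val n adj g x y sc))"
        unfolding D_def using G
        by (intro run_detect[where ord = "\<lambda>x. gorder G ! x"])
          (auto simp: detection_input_def adj_def M_def)
      then show "\<exists>u s'. exec w (detect mm N (2 * d) t sc) s u s' \<and>
          u \<le> D * (n * n + 1 + T n) * (n ^ (2 * d) + 1) \<and> detection_output P n G s'"
        using w(2) unfolding run_def detection_output_def plan[OF G'] adj_def[abs_def] of_bool_def by blast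
    qed
    then show ?thesis
      unfolding d_def by blast
  qed
qed

end
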